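(* Let $k\geq 1$. For every partition $(j_1,\ldots,j_r)$ of $k$ (integers $j_1\geq\cdots\geq j_r\geq1$ with sum $k$), the coefficient $h_{j_1,\ldots,j_r}$ of $p_{j_1}\cdots p_{j_r}$ in the Hirzebruch $L$-polynomial $L_k$ is non-zero. It is negative if $r$ is even and positive if $r$ is odd.
   Context: The Hirzebruch $L$-polynomials $L_k=L_k(p_1,\ldots,p_k)$ are the polynomials with rational coefficients in indeterminates $p_1,p_2,\ldots$ forming the multiplicative sequence with characteristic power series $Q(z)=\frac{\sqrt z}{\tanh\sqrt z}\in\mathbb{Q}[[z]]$. Explicitly, for any $m\geq k$, if $p_i$ is replaced by the $i$th elementary symmetric polynomial in $x_1,\ldots,x_m$, then $L_k(p_1,\ldots,p_k)$ is the homogeneous degree $k$ part of $Q(x_1)\cdots Q(x_m)$; this determines $L_k$ uniquely. For example $L_1=\frac13 p_1$, $L_2=\frac1{45}(7p_2-p_1^2)$, $L_3=\frac{1}{945}(62p_3-13p_2p_1+2p_1^3)$. One writes $L_k=\sum h_{j_1,\ldots,j_r}p_{j_1}\cdots p_{j_r}$, the sum being over all partitions $(j_1,\ldots,j_r)$ of $k$. *)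

theory Defs
  imports
    Complex_Main
    "HOL-Library.Poly_Mapping"
    "HOL-Computational_Algebra.Formal_Power_Series"
begin

text \<open>Polynomials over the rationals in indeterminates indexed by the natural numbers: a
  monomial is its finitely supported exponent function, and a polynomial is a finitely
  supported map from monomials to coefficients, with convolution as product.\<close>

type_synonym rat_mpoly = "(nat \<Rightarrow>\<^sub>0 nat) \<Rightarrow>\<^sub>0 rat"

definition mp_const :: "rat \<Rightarrow> rat_mpoly" where
  "mp_const c = Poly_Mapping.single 0 c"

definition mp_var :: "nat \<Rightarrow> rat_mpoly" where
  "mp_var i = Poly_Mapping.single (Poly_Mapping.single i 1) 1"

definition mp_coeff :: "rat_mpoly \<Rightarrow> (nat \<Rightarrow>\<^sub>0 nat) \<Rightarrow> rat" where
  "mp_coeff P a = Poly_Mapping.lookup P a"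

definition mp_vars :: "rat_mpoly \<Rightarrow> nat set" where
  "mp_vars P = (\<Union>a\<in>Poly_Mapping.keys P. Poly_Mapping.keys a)"

definition mp_subst :: "(nat \<Rightarrow> rat_mpoly) \<Rightarrow> rat_mpoly \<Rightarrow> rat_mpoly" where
  "mp_subst f P = (\<Sum>a\<in>Poly_Mapping.keys P.
     mp_const (mp_coeff P a) * (\<Prod>i\<in>Poly_Mapping.keys a. f i ^ Poly_Mapping.lookup a i))"

definition elem_sym :: "nat \<Rightarrow> nat \<Rightarrow> rat_mpoly" where
  "elem_sym m i = (\<Sum>S | S \<subseteq> {1..m} \<and> card S = i. \<Prod>j\<in>S. mp_var j)"

definition fps_tanh :: "rat fps" where
  "fps_tanh = (fps_exp 1 - fps_exp (- 1)) / (fps_exp 1 + fps_exp (- 1))"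

text \<open>The series \<open>w / tanh w\<close> is even, and \<open>Q z\<close> arises from it by replacing \<open>w\<^sup>2\<close> by \<open>z\<close>;
  the lemma \<open>hirzebruch_Q_square\<close> below states \<open>Q (w\<^sup>2) = w / tanh w\<close>.\<close>

definition hirzebruch_Q :: "rat fps" where
  "hirzebruch_Q = Abs_fps (\<lambda>n. fps_nth (fps_X / fps_tanh) (2 * n))"

text \<open>Homogeneous parts of the power series \<open>Q x\<^sub>1 \<cdots> Q x\<^sub>m\<close> are separated by an additional
  grading variable \<open>t\<close>: the part of degree \<open>k\<close> is the coefficient of \<open>t\<^sup>k\<close> in
  \<open>Q (x\<^sub>1 t) \<cdots> Q (x\<^sub>m t)\<close>.\<close>

definition Q_at_var :: "nat \<Rightarrow> rat_mpoly fps" where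
  "Q_at_var i = Abs_fps (\<lambda>n. mp_const (fps_nth hirzebruch_Q n) * mp_var i ^ n)"

definition Q_product_part :: "nat \<Rightarrow> nat \<Rightarrow> rat_mpoly" where
  "Q_product_part m k = fps_nth (\<Prod>i\<in>{1..m}. Q_at_var i) k"

definition is_hirzebruch_L :: "nat \<Rightarrow> rat_mpoly \<Rightarrow> bool" where
  "is_hirzebruch_L k P \<longleftrightarrow>
     mp_vars P \<subseteq> {1..k} \<and> (\<forall>m\<ge>k. mp_subst (elem_sym m) P = Q_product_part m k)"

definition hirzebruch_L :: "nat \<Rightarrow> rat_mpoly" where
  "hirzebruch_L k = (THE P. is_hirzebruch_L k P)"

definition is_partition :: "nat list \<Rightarrow> nat \<Rightarrow> bool" where
  "is_partition js k \<longleftrightarrow> sorted_wrt (\<ge>) js \<and> (\<forall>j\<in>set js. 1 \<le> j) \<and> sum_list js = k"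

text \<open>The exponent function of the monomial \<open>p\<^sub>j\<^sub>1 \<cdots> p\<^sub>j\<^sub>r\<close>; it counts how often each index
  occurs in the list.\<close>

definition index_monomial :: "nat list \<Rightarrow> (nat \<Rightarrow>\<^sub>0 nat)" where
  "index_monomial js = (\<Sum>j\<leftarrow>js. Poly_Mapping.single j 1)"

definition L_coeff :: "nat list \<Rightarrow> nat \<Rightarrow> rat" where
  "L_coeff js k = mp_coeff (hirzebruch_L k) (index_monomial js)"


lemma fps_tanh_mult: "fps_tanh * (fps_exp 1 + fps_exp (- 1)) = fps_exp 1 - fps_exp (- 1)"
  by (simp add: fps_tanh_def fps_divide_unit mult.assoc inverse_mult_eq_1)

lemma fps_tanh_nth_0: "fps_nth fps_tanh 0 = 0"
  by (simp add: fps_tanh_def fps_divide_unit)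

lemma fps_tanh_nth_1: "fps_nth fps_tanh 1 = 1"
proof -
  have "fps_nth (fps_tanh * (fps_exp 1 + fps_exp (- 1))) 1
          = fps_nth (fps_exp 1 - fps_exp (- 1) :: rat fps) 1"
    by (simp only: fps_tanh_mult)
  then show ?thesis
    by (simp add: fps_mult_nth_1 fps_tanh_nth_0)
qed

lemma fps_X_div_tanh_mult: "fps_X / fps_tanh * fps_tanh = fps_X"
proof -
  have nz: "fps_tanh \<noteq> 0"
    using fps_tanh_nth_1 by auto
  have "subdegree fps_tanh = 1"
    by (rule subdegreeI) (use fps_tanh_nth_0 fps_tanh_nth_1 in auto)
  then have "fps_tanh dvd fps_X"
    using nz by (simp add: fps_dvd_iff)
  then show ?thesis
    by simp
qed

lemma fps_tanh_odd: "fps_tanh oo (- fps_X) = - fps_tanh"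
proof -
  let ?s = "fps_exp 1 - fps_exp (- 1) :: rat fps"
  let ?c = "fps_exp 1 + fps_exp (- 1) :: rat fps"
  have e: "fps_exp (a::rat) oo (- fps_X) = fps_exp (- a)" for a
    by (rule fps_ext) (simp add: fps_compose_uminus' power_minus[of a])
  have "(fps_tanh oo (- fps_X)) * (?c oo (- fps_X)) = ?s oo (- fps_X)"
    by (simp add: fps_tanh_mult flip: fps_compose_mult_distrib)
  then have "(fps_tanh oo (- fps_X)) * ?c = - ?s"
    by (simp add: fps_compose_add_distrib fps_compose_sub_distrib e add.commute)
  then have "(fps_tanh oo (- fps_X)) * ?c = (- fps_tanh) * ?c"
    by (simp add: fps_tanh_mult)
  moreover have "fps_nth ?c 0 \<noteq> 0"
    by simp
  then have "?c \<noteq> 0"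
    by (metis fps_zero_nth)
  ultimately show ?thesis
    by (metis mult_right_cancel)
qed

lemma fps_X_div_tanh_even: "(fps_X / fps_tanh) oo (- fps_X) = fps_X / fps_tanh"
proof -
  let ?F = "fps_X / fps_tanh"
  have "(?F oo (- fps_X)) * (fps_tanh oo (- fps_X)) = fps_X oo (- fps_X)"
    by (simp add: fps_X_div_tanh_mult flip: fps_compose_mult_distrib)
  then have "(?F oo (- fps_X)) * fps_tanh = ?F * fps_tanh"
    by (simp add: fps_tanh_odd fps_X_div_tanh_mult)
  moreover have "fps_tanh \<noteq> 0"
    using fps_tanh_nth_1 by auto
  ultimately show ?thesis
    by (metis mult_right_cancel)
qed

lemma hirzebruch_Q_square: "hirzebruch_Q oo fps_X ^ 2 = fps_X / fps_tanh"
proof (rule fps_ext)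
  fix n
  let ?F = "fps_X / fps_tanh"
  have "fps_nth (hirzebruch_Q oo fps_X ^ 2) n
          = (\<Sum>i=0..n. fps_nth hirzebruch_Q i * (if n = 2 * i then 1 else 0))"
    by (simp add: fps_compose_nth flip: power_mult)
  also have "\<dots> = fps_nth ?F n"
  proof (cases "even n")
    case True
    then obtain q where q: "n = 2 * q" by blast
    have "(\<Sum>i=0..n. fps_nth hirzebruch_Q i * (if n = 2 * i then 1 else 0))
            = (\<Sum>i=0..n. if i = q then fps_nth hirzebruch_Q q else 0)"
      by (rule sum.cong) (auto simp: q)
    then show ?thesis
      by (simp add: q hirzebruch_Q_def)
  next
    case False
    have "fps_nth (?F oo (- fps_X)) n = (- 1) ^ n * fps_nth ?F n"
      by (simp add: fps_compose_uminus')
    with False have "fps_nth ?F n = 0"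
      by (simp add: fps_X_div_tanh_even)
    moreover have "(\<Sum>i=0..n. fps_nth hirzebruch_Q i * (if n = 2 * i then 1 else 0)) = 0"
      using False by (intro sum.neutral) auto
    ultimately show ?thesis by simp
  qed
  finally show "fps_nth (hirzebruch_Q oo fps_X ^ 2) n = fps_nth ?F n" .
qed

end

theory Submission
  imports
    Defs
    "HOL-Analysis.Gamma_Function"
    "HOL-Complex_Analysis.Cauchy_Integral_Formula"
begin

text \<open>The coefficient of \<open>p\<^bsub>j\<^sub>1\<^esub> \<dots> p\<^bsub>j\<^sub>r\<^esub>\<close> is a monomial symmetric function of the zeros and poles of \<open>Q\<close>, and its sign
comes from the fact that these zeros and poles interlace.

If \<open>Q(z)\<close> were a finite product \<open>\<Prod>(1 + x\<^sub>i z) / \<Prod>(1 + y\<^sub>i z)\<close>, then, with \<open>E(t) = \<Prod>(1 + X\<^sub>j t) = \<Sum> e\<^sub>i t\<^sup>i\<close> in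
the variables \<open>X\<^sub>j\<close>, exchanging the two products would give
\<open>\<Prod>\<^sub>j Q(X\<^sub>j t) = \<Prod>\<^sub>i E(x\<^sub>i t) / \<Prod>\<^sub>i E(y\<^sub>i t)\<close>. Hence \<open>L\<^sub>k\<close> would be obtained by expanding the right hand side
for \<open>E(t) = 1 + p\<^sub>1 t + p\<^sub>2 t\<^sup>2 + \<dots>\<close>. If the factors are multiplied in a fixed order without
commuting the \<open>p\<^sub>i\<close>, the coefficient of the word \<open>p\<^bsub>\<alpha>\<^sub>1\<^esub> \<dots> p\<^bsub>\<alpha>\<^sub>r\<^esub>\<close> is a monomial quasisymmetric function
\<open>M\<^sub>\<alpha>\<close> of the signed alphabet of the \<open>x\<^sub>i\<close> (positive) and \<open>y\<^sub>i\<close> (negative), and the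
coefficient of a monomial is the sum of these over all rearrangements of its indices.

Let \<open>x\<^sub>0 > y\<^sub>0 > x\<^sub>1 > y\<^sub>1 > \<dots> > 0\<close> and take the letters in this order, grouped as \<open>x\<^sub>0\<close> followed by the
pairs \<open>- y\<^sub>i + x\<^bsub>i+1\<^esub>\<close>. For one pair, and hence for the union of all pairs, \<open>M\<^sub>\<alpha>\<close> has the sign
\<open>(-1)\<^sup>r\<close>. Adding \<open>x\<^sub>0\<close> in front adds \<open>x\<^sub>0\<close> to the power \<open>\<alpha>\<^sub>1\<close> times \<open>M\<close> of the remaining \<open>r - 1\<close> parts, of sign
\<open>(-1)\<^bsup>r-1\<^esup>\<close>. This term wins, because for the pairs \<open>|M\<^sub>\<alpha>|\<close> is at most \<open>y\<^sub>0\<close> to the power \<open>\<alpha>\<^sub>1\<close> times \<open>|M|\<close>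
of the remaining parts (lemmas \<open>signed_pairs_bounds\<close> and \<open>alphabet_qsym_sign\<close>). So every \<open>M\<^sub>\<alpha>\<close> is nonzero with
the sign \<open>(-1)\<^bsup>r-1\<^esup>\<close>, and with an explicit lower bound that does not depend on the number of letters.

The actual \<open>Q\<close> is \<open>cosh \<surd>z\<close> divided by \<open>sinh \<surd>z / \<surd>z\<close>, with \<open>x\<^sub>i = 4 / (\<pi> (2 i + 1))\<^sup>2\<close> and
\<open>y\<^sub>i = 1 / (\<pi> (i + 1))\<^sup>2\<close>, which do interlace. The passage to the limit is made through power sums: those
of the finite alphabets converge to the coefficients of \<open>z Q'(z) / Q(z)\<close>, up to alternating signs
(lemma \<open>power_sums_tendsto_log_deriv_Q\<close>), and the coefficients of \<open>L\<^sub>k\<close> are polynomials in the power sums,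
because the generating series \<open>F\<close> of the \<open>L\<^sub>k\<close> solves the differential equation \<open>t F' = H F\<close> with
\<open>H = \<Sum> q\<^sub>n \<pi>\<^sub>n t\<^sup>n\<close>; here \<open>q\<^sub>n\<close> are the power sums of the alphabet and \<open>\<Sum> \<pi>\<^sub>n t\<^sup>n = t E'(t) / E(t)\<close>. The uniform
lower bound keeps the inequality strict in the limit.

The differential equation also provides the polynomial over the rationals with the defining property of
\<open>L\<^sub>k\<close>; that there is only one follows from the algebraic independence of the elementary symmetric
polynomials (lemmas \<open>hirzebruch_L_eq\<close> and \<open>elem_sym_independent\<close>).\<close>

section \<open>Series indexed by compositions\<close>

definition compositions :: "nat \<Rightarrow> nat list set" where
  "compositions k = {\<alpha>. 0 \<notin> set \<alpha> \<and> sum_list \<alpha> = k}"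

lemma compositions_0 [simp]: "compositions 0 = {[]}"
proof -
  have "\<alpha> = []" if "\<alpha> \<in> compositions 0" for \<alpha>
    using that by (cases \<alpha>) (auto simp: compositions_def)
  then show ?thesis by (auto simp: compositions_def)
qed

lemma compositions_rec:
  assumes "k > 0"
  shows "compositions k = (\<Union>j\<in>{1..k}. (#) j ` compositions (k - j))"
proof (intro set_eqI iffI)
  fix \<alpha> assume a: "\<alpha> \<in> compositions k"
  with assms obtain j \<beta> where "\<alpha> = j # \<beta>"
    by (cases \<alpha>) (auto simp: compositions_def)
  with a show "\<alpha> \<in> (\<Union>j\<in>{1..k}. (#) j ` compositions (k - j))"
    by (intro UN_I[of j]) (auto simp: compositions_def)
qed (auto simp: compositions_def)

lemma finite_compositions [simp]: "finite (compositions k)"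
proof (induction k rule: less_induct)
  case (less k)
  then show ?case
    by (cases "k = 0") (auto simp: compositions_rec)
qed

text \<open>The map from functions on compositions to power series is the commutative shadow of the free
algebra on letters \<open>p\<^sub>1, p\<^sub>2, \<dots>\<close>: a composition \<open>\<alpha>\<close> stands for the word \<open>p\<^bsub>\<alpha>\<^sub>1\<^esub> p\<^bsub>\<alpha>\<^sub>2\<^esub> \<dots>\<close>,
graded by its sum. Keeping the order of the parts is what makes the sign analysis possible, since
the coefficients of words have simple recursions in a signed alphabet while those of monomials
do not.\<close>
definition comp_series :: "(nat \<Rightarrow> 'b) \<Rightarrow> (nat list \<Rightarrow> 'b) \<Rightarrow> 'b::comm_ring_1 fps" where
  "comp_series p f = Abs_fps (\<lambda>k. \<Sum>\<alpha>\<in>compositions k. f \<alpha> * prod_list (map p \<alpha>))"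

text \<open>The product dual to deconcatenation, which is the product of the free algebra read off on
coefficients.\<close>
definition deconc :: "(nat list \<Rightarrow> 'b) \<Rightarrow> (nat list \<Rightarrow> 'b) \<Rightarrow> nat list \<Rightarrow> 'b::comm_ring_1" where
  "deconc f g \<alpha> = (\<Sum>i\<le>length \<alpha>. f (take i \<alpha>) * g (drop i \<alpha>))"

lemma comp_series_nth:
  "fps_nth (comp_series p f) k = (\<Sum>\<alpha>\<in>compositions k. f \<alpha> * prod_list (map p \<alpha>))"
  by (simp add: comp_series_def)

lemma comp_series_cong:
  "(\<And>\<alpha>. 0 \<notin> set \<alpha> \<Longrightarrow> f \<alpha> = g \<alpha>) \<Longrightarrow> comp_series p f = comp_series p g"
  by (rule fps_ext) (auto simp: comp_series_nth compositions_def intro!: sum.cong)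

text \<open>Cutting a composition at a position is the same as choosing two compositions whose sums add up.\<close>
lemma comp_series_mult: "comp_series p f * comp_series p g = comp_series p (deconc f g)"
proof (rule fps_ext)
  fix k
  let ?w = "\<lambda>\<alpha>. prod_list (map p \<alpha>)"
  have "fps_nth (comp_series p (deconc f g)) k
    = (\<Sum>\<alpha>\<in>compositions k. \<Sum>i\<le>length \<alpha>. f (take i \<alpha>) * g (drop i \<alpha>) * ?w \<alpha>)"
    by (simp add: comp_series_nth deconc_def sum_distrib_right)
  also have "\<dots> = (\<Sum>(\<alpha>, i)\<in>Sigma (compositions k) (\<lambda>\<alpha>. {..length \<alpha>}).
      f (take i \<alpha>) * g (drop i \<alpha>) * ?w \<alpha>)"
    by (simp add: sum.Sigma)
  also have "\<dots> = (\<Sum>(n, \<beta>, \<gamma>)\<in>Sigma {0..k} (\<lambda>n. compositions n \<times> compositions (k - n)).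
      f \<beta> * g \<gamma> * ?w (\<beta> @ \<gamma>))"
  proof (rule sum.reindex_bij_witness
      [where i = "\<lambda>(n, \<beta>, \<gamma>). (\<beta> @ \<gamma>, length \<beta>)"
       and j = "\<lambda>(\<alpha>, i). (sum_list (take i \<alpha>), take i \<alpha>, drop i \<alpha>)"])
    fix a assume "a \<in> Sigma (compositions k) (\<lambda>\<alpha>. {..length \<alpha>})"
    then obtain \<alpha> i where a: "a = (\<alpha>, i)" "0 \<notin> set \<alpha>" "sum_list \<alpha> = k" "i \<le> length \<alpha>"
      by (auto simp: compositions_def)
    have "sum_list (take i \<alpha>) + sum_list (drop i \<alpha>) = k"
      using a(3) by (metis append_take_drop_id sum_list_append)
    then show "(case a of (\<alpha>, i) \<Rightarrow> (sum_list (take i \<alpha>), take i \<alpha>, drop i \<alpha>))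
        \<in> Sigma {0..k} (\<lambda>n. compositions n \<times> compositions (k - n))"
      using a by (auto simp: compositions_def dest: in_set_takeD in_set_dropD)
  qed (auto simp: compositions_def simp flip: prod_list.append map_append)
  also have "\<dots> = (\<Sum>n=0..k. \<Sum>\<beta>\<in>compositions n. \<Sum>\<gamma>\<in>compositions (k - n).
      f \<beta> * ?w \<beta> * (g \<gamma> * ?w \<gamma>))"
    by (simp add: sum.Sigma mult_ac case_prod_unfold)
  also have "\<dots> = fps_nth (comp_series p f * comp_series p g) k"
    by (simp add: fps_mult_nth comp_series_nth sum_product)
  finally show "fps_nth (comp_series p f * comp_series p g) k
    = fps_nth (comp_series p (deconc f g)) k" ..
qed

lemma X_deriv_comp_series:
  "fps_X * fps_deriv (comp_series p f) = comp_series p (\<lambda>\<alpha>. of_nat (sum_list \<alpha>) * f \<alpha>)"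
  by (rule fps_ext)
    (auto simp: comp_series_nth sum_distrib_left compositions_def mult.assoc gr0_conv_Suc add.commute
      intro!: sum.cong sum.neutral)

text \<open>With \<open>E(t) = 1 + p\<^sub>1 t + p\<^sub>2 t\<^sup>2 + \<dots>\<close>, the logarithmic derivative \<open>t E'(t) / E(t)\<close> is the product of
\<open>\<Sum> n p\<^sub>n t\<^sup>n\<close> and \<open>1 / E(t) = \<Sum>\<^sub>\<alpha> (-1)\<^bsup>length \<alpha>\<^esup> p\<^sub>\<alpha> t\<^bsup>|\<alpha>|\<^esup>\<close>; the factor \<open>hd \<alpha>\<close> is the \<open>n\<close> of the first
series. Multiplying the coefficient of \<open>t\<^sup>n\<close> by \<open>q n\<close> gives the logarithmic derivative of the
product of \<open>E(x t)\<close> over an alphabet of letters \<open>x\<close> with power sums \<open>q n\<close>.\<close>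
definition power_sum_coeff :: "(nat \<Rightarrow> 'b) \<Rightarrow> nat list \<Rightarrow> 'b::comm_ring_1" where
  "power_sum_coeff q \<alpha> =
    (if \<alpha> = [] then 0 else q (sum_list \<alpha>) * (- 1) ^ (length \<alpha> - 1) * of_nat (hd \<alpha>))"

abbreviation log_deriv_series :: "(nat \<Rightarrow> 'b) \<Rightarrow> (nat \<Rightarrow> 'b) \<Rightarrow> 'b::comm_ring_1 fps" where
  "log_deriv_series p q \<equiv> comp_series p (power_sum_coeff q)"

lemma log_deriv_series_nth:
  "fps_nth (log_deriv_series p q) n = q n * fps_nth (log_deriv_series p (\<lambda>_. 1)) n"
  by (auto simp: comp_series_nth sum_distrib_left compositions_def power_sum_coeff_def mult_ac
      intro!: sum.cong)

lemma log_deriv_series_0 [simp]: "fps_nth (log_deriv_series p q) 0 = 0"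
  by (simp add: comp_series_nth power_sum_coeff_def)

lemma log_deriv_series_add:
  "log_deriv_series p (\<lambda>n. q n + r n) = log_deriv_series p q + log_deriv_series p r"
  by (rule fps_ext) (simp add: log_deriv_series_nth[of p "\<lambda>n. q n + r n"]
      log_deriv_series_nth[of p q] log_deriv_series_nth[of p r] algebra_simps)

lemma log_deriv_series_diff:
  "log_deriv_series p (\<lambda>n. q n - r n) = log_deriv_series p q - log_deriv_series p r"
  by (rule fps_ext) (simp add: log_deriv_series_nth[of p "\<lambda>n. q n - r n"]
      log_deriv_series_nth[of p q] log_deriv_series_nth[of p r] algebra_simps)

text \<open>The coefficients of \<open>E(x t)\<close>, in which only words of length at most one occur.\<close>
fun letter :: "'b \<Rightarrow> nat list \<Rightarrow> 'b::comm_ring_1" where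
  "letter x [] = 1"
| "letter x [j] = x ^ j"
| "letter x (i # j # \<alpha>) = 0"

lemma letter_eq_0: "length \<alpha> \<ge> 2 \<Longrightarrow> letter x \<alpha> = 0"
  by (cases "(x, \<alpha>)" rule: letter.cases) auto

lemma comp_series_letter_nth:
  "fps_nth (comp_series p (letter x)) n = (if n = 0 then 1 else x ^ n * p n)"
proof (cases "n = 0")
  case False
  have "(\<Sum>\<alpha>\<in>compositions n. letter x \<alpha> * prod_list (map p \<alpha>))
    = (\<Sum>\<alpha>\<in>{[n]}. letter x \<alpha> * prod_list (map p \<alpha>))"
  proof (rule sum.mono_neutral_right)
    show "\<forall>\<alpha>\<in>compositions n - {[n]}. letter x \<alpha> * prod_list (map p \<alpha>) = 0"
    proof
      fix \<alpha> assume "\<alpha> \<in> compositions n - {[n]}"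
      then show "letter x \<alpha> * prod_list (map p \<alpha>) = 0"
        using False by (cases "(x, \<alpha>)" rule: letter.cases) (auto simp: compositions_def)
    qed
  qed (use False in \<open>auto simp: compositions_def simp del: finite_compositions
      intro: finite_compositions[unfolded compositions_def]\<close>)
  with False show ?thesis
    by (simp add: comp_series_nth)
qed (simp add: comp_series_nth)

text \<open>Only the cuts at the end of the word and before its last letter contribute, because a letter
vanishes on longer words. For words of length at least two these two terms cancel.\<close>
lemma letter_log_deriv:
  "of_nat (sum_list \<alpha>) * letter x \<alpha> = deconc (power_sum_coeff (\<lambda>n. x ^ n)) (letter x) \<alpha>"
proof (cases \<alpha> rule: rev_cases)
  case Nil
  then show ?thesis by (simp add: deconc_def power_sum_coeff_def)
next
  case (snoc \<beta> j)
  let ?f = "\<lambda>i. power_sum_coeff (\<lambda>n. x ^ n) (take i \<alpha>) * letter x (drop i \<alpha>)"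
  have z: "letter x (drop i \<beta> @ [j]) = 0" if "i < length \<beta>" for i
    using that by (intro letter_eq_0) simp
  have "deconc (power_sum_coeff (\<lambda>n. x ^ n)) (letter x) \<alpha> = (\<Sum>i\<in>{length \<beta>, Suc (length \<beta>)}. ?f i)"
    unfolding deconc_def
    by (rule sum.mono_neutral_right) (auto simp: snoc le_Suc_eq le_less z)
  also have "\<dots> = of_nat (sum_list \<alpha>) * letter x \<alpha>"
  proof (cases \<beta>)
    case (Cons i \<gamma>)
    then have "letter x \<alpha> = 0"
      by (intro letter_eq_0) (simp add: snoc)
    with Cons show ?thesis
      by (simp add: snoc power_sum_coeff_def power_add mult_ac)
  qed (simp add: snoc power_sum_coeff_def)
  finally show ?thesis ..
qed

lemma letter_series_deriv:
  "fps_X * fps_deriv (comp_series p (letter x))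
    = log_deriv_series p (\<lambda>n. x ^ n) * comp_series p (letter x)"
  unfolding X_deriv_comp_series comp_series_mult
  by (rule comp_series_cong) (rule letter_log_deriv)

text \<open>Comparing coefficients of \<open>t\<^sup>n\<close> expresses \<open>n F\<^sub>n\<close> by \<open>F\<^sub>0, \<dots>, F\<^bsub>n-1\<^esub>\<close>, because the constant coefficient
of \<open>H\<close> vanishes; in characteristic zero this determines \<open>F\<close>. This is the tool for identifying the
three different descriptions of the generating series of the \<open>L\<close>-polynomials.\<close>
lemma log_deriv_unique:
  fixes F G H :: "'b::{idom,ring_char_0} fps"
  assumes F: "fps_X * fps_deriv F = H * F" and G: "fps_X * fps_deriv G = H * G"
    and H: "fps_nth H 0 = 0" and 0: "fps_nth F 0 = fps_nth G 0"
  shows "F = G"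
proof (rule fps_ext)
  fix n show "fps_nth F n = fps_nth G n"
  proof (induction n rule: less_induct)
    case (less n)
    show ?case
    proof (cases n)
      case (Suc m)
      have step: "of_nat n * fps_nth U n = (\<Sum>i=1..n. fps_nth H i * fps_nth U (n - i))"
        if "fps_X * fps_deriv U = H * U" for U
      proof -
        have "of_nat n * fps_nth U n = fps_nth (fps_X * fps_deriv U) n"
          using Suc by simp
        also have "\<dots> = (\<Sum>i=0..n. fps_nth H i * fps_nth U (n - i))"
          by (simp only: that fps_mult_nth)
        also have "\<dots> = (\<Sum>i=1..n. fps_nth H i * fps_nth U (n - i))"
          by (rule sum.mono_neutral_right) (auto simp: H not_le less_Suc_eq)
        finally show ?thesis .
      qed
      have "of_nat n * fps_nth F n = of_nat n * fps_nth G n"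
        unfolding step[OF F] step[OF G] by (rule sum.cong) (auto simp: less.IH)
      then show ?thesis using Suc by (simp del: of_nat_Suc)
    qed (simp add: 0)
  qed
qed

section \<open>Quasisymmetric functions of a signed alphabet\<close>

text \<open>The monomial quasisymmetric functions of an ordered alphabet, as functions of the composition,
change in this way when a letter \<open>x\<close> is put in front of it: either \<open>x\<close> is not used or it carries
the first part.\<close>
fun add_letter :: "'b \<Rightarrow> (nat list \<Rightarrow> 'b) \<Rightarrow> nat list \<Rightarrow> 'b::comm_ring_1" where
  "add_letter x M [] = M []"
| "add_letter x M (j # \<alpha>) = M (j # \<alpha>) + x ^ j * M \<alpha>"

text \<open>The inverse of adding a letter in front, that is, the effect of a letter \<open>y\<close> of negative sign.\<close>
fun remove_letter :: "'b \<Rightarrow> (nat list \<Rightarrow> 'b) \<Rightarrow> nat list \<Rightarrow> 'b::comm_ring_1" where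
  "remove_letter y M [] = M []"
| "remove_letter y M (j # \<alpha>) = M (j # \<alpha>) - y ^ j * remove_letter y M \<alpha>"

lemma letter_Cons: "letter x (j # \<alpha>) = x ^ j * of_bool (\<alpha> = [])"
  by (cases \<alpha>) auto

text \<open>Only the cuts before and after the first part contribute.\<close>
lemma add_letter_deconc: "add_letter x M = deconc (letter x) M"
proof
  fix \<alpha> show "add_letter x M \<alpha> = deconc (letter x) M \<alpha>"
  proof (cases \<alpha>)
    case (Cons j \<beta>)
    have "deconc (letter x) M \<alpha> = M (j # \<beta>) + (\<Sum>i\<le>length \<beta>. x ^ j * of_bool (take i \<beta> = []) * M (drop i \<beta>))"
      unfolding deconc_def Cons length_Cons sum.atMost_Suc_shift by (simp add: letter_Cons)
    also have "(\<Sum>i\<le>length \<beta>. x ^ j * of_bool (take i \<beta> = []) * M (drop i \<beta>))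
      = (\<Sum>i\<in>{0}. x ^ j * of_bool (take i \<beta> = []) * M (drop i \<beta>))"
      by (rule sum.mono_neutral_right) auto
    finally show ?thesis by (simp add: Cons)
  qed (simp add: deconc_def)
qed

lemma add_remove_letter: "add_letter y (remove_letter y M) = M"
proof
  fix \<alpha> show "add_letter y (remove_letter y M) \<alpha> = M \<alpha>"
    by (cases \<alpha>) auto
qed

text \<open>The alphabet \<open>- y\<^sub>i + x\<^bsub>i+1\<^esub> - y\<^bsub>i+1\<^esub> + x\<^bsub>i+2\<^esub> - \<dots>\<close> consisting of \<open>n\<close> pairs. Pairing each negative letter
with the following positive one makes the sign of every word depend only on its length, see below.\<close>
fun pairs_qsym :: "(nat \<Rightarrow> 'b) \<Rightarrow> (nat \<Rightarrow> 'b) \<Rightarrow> nat \<Rightarrow> nat \<Rightarrow> nat list \<Rightarrow> 'b::comm_ring_1" where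
  "pairs_qsym x y 0 i = (\<lambda>\<alpha>. of_bool (\<alpha> = []))"
| "pairs_qsym x y (Suc n) i =
     remove_letter (y i) (add_letter (x (Suc i)) (pairs_qsym x y n (Suc i)))"

text \<open>The alphabet \<open>x\<^sub>0 - y\<^sub>0 + x\<^sub>1 - \<dots> - y\<^bsub>n-1\<^esub> + x\<^sub>n\<close>. Its word series is the product of
\<open>E(x\<^sub>0 t) \<dots> E(x\<^sub>n t)\<close> divided by \<open>E(y\<^sub>0 t) \<dots> E(y\<^bsub>n-1\<^esub> t)\<close>.\<close>
definition alphabet_qsym :: "(nat \<Rightarrow> 'b) \<Rightarrow> (nat \<Rightarrow> 'b) \<Rightarrow> nat \<Rightarrow> nat list \<Rightarrow> 'b::comm_ring_1" where
  "alphabet_qsym x y n = add_letter (x 0) (pairs_qsym x y n 0)"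

lemma comp_series_add_letter:
  "comp_series p (add_letter x M) = comp_series p (letter x) * comp_series p M"
  by (simp add: add_letter_deconc comp_series_mult)

lemma log_deriv_add_letter:
  assumes "fps_X * fps_deriv (comp_series p M) = log_deriv_series p q * comp_series p M"
  shows "fps_X * fps_deriv (comp_series p (add_letter x M))
    = log_deriv_series p (\<lambda>n. x ^ n + q n) * comp_series p (add_letter x M)"
proof -
  let ?E = "comp_series p (letter x)" and ?F = "comp_series p M"
  have "fps_X * fps_deriv (?E * ?F) = (fps_X * fps_deriv ?E) * ?F + ?E * (fps_X * fps_deriv ?F)"
    by (simp add: algebra_simps)
  also have "\<dots> = log_deriv_series p (\<lambda>n. x ^ n + q n) * (?E * ?F)"
    unfolding assms letter_series_deriv log_deriv_series_add by (simp add: algebra_simps)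
  finally show ?thesis by (simp add: comp_series_add_letter)
qed

lemma log_deriv_remove_letter:
  fixes p :: "nat \<Rightarrow> 'b::idom"
  assumes "fps_X * fps_deriv (comp_series p M) = log_deriv_series p q * comp_series p M"
  shows "fps_X * fps_deriv (comp_series p (remove_letter y M))
    = log_deriv_series p (\<lambda>n. q n - y ^ n) * comp_series p (remove_letter y M)"
proof -
  let ?E = "comp_series p (letter y)" and ?F = "comp_series p (remove_letter y M)"
  have M: "comp_series p M = ?E * ?F"
    by (metis add_remove_letter comp_series_add_letter)
  have "?E * (fps_X * fps_deriv ?F) = fps_X * fps_deriv (?E * ?F) - (fps_X * fps_deriv ?E) * ?F"
    by (simp add: algebra_simps)
  also have "\<dots> = ?E * (log_deriv_series p (\<lambda>n. q n - y ^ n) * ?F)"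
    unfolding assms[unfolded M] letter_series_deriv log_deriv_series_diff by (simp add: algebra_simps)
  finally have *: "?E * (fps_X * fps_deriv ?F) = ?E * (log_deriv_series p (\<lambda>n. q n - y ^ n) * ?F)" .
  have "fps_nth ?E 0 = 1"
    by (simp add: comp_series_letter_nth)
  then have "?E \<noteq> 0"
    by auto
  with * show ?thesis
    by simp
qed

lemma log_deriv_pairs_qsym:
  fixes p :: "nat \<Rightarrow> 'b::idom"
  shows "fps_X * fps_deriv (comp_series p (pairs_qsym x y n i))
    = log_deriv_series p (\<lambda>m. (\<Sum>l<n. x (Suc (i + l)) ^ m) - (\<Sum>l<n. y (i + l) ^ m))
      * comp_series p (pairs_qsym x y n i)"
proof (induction n arbitrary: i)
  case 0
  have "comp_series p (\<lambda>\<alpha>. of_bool (\<alpha> = [])) = fps_const 1"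
  proof (rule fps_ext)
    fix k show "fps_nth (comp_series p (\<lambda>\<alpha>. of_bool (\<alpha> = []))) k = fps_nth (fps_const 1) k"
      by (cases "k = 0") (auto simp: comp_series_nth compositions_def[of k] intro!: sum.neutral)
  qed
  moreover have "log_deriv_series p (\<lambda>m. 0) = 0"
    by (rule fps_ext) (simp add: log_deriv_series_nth[of p "\<lambda>m. 0"])
  ultimately show ?case by simp
next
  case (Suc n)
  have eq: "(\<lambda>m. x (Suc i) ^ m + ((\<Sum>l<n. x (Suc (Suc i + l)) ^ m) - (\<Sum>l<n. y (Suc i + l) ^ m)) - y i ^ m)
    = (\<lambda>m. (\<Sum>l<Suc n. x (Suc (i + l)) ^ m) - (\<Sum>l<Suc n. y (i + l) ^ m))"
    unfolding sum.lessThan_Suc_shift by (simp add: algebra_simps)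
  show ?case
    unfolding pairs_qsym.simps
    using log_deriv_remove_letter[OF log_deriv_add_letter[OF Suc.IH[of "Suc i"], of "x (Suc i)"], of "y i"]
    unfolding eq .
qed

lemma log_deriv_alphabet_qsym:
  fixes p :: "nat \<Rightarrow> 'b::idom"
  shows "fps_X * fps_deriv (comp_series p (alphabet_qsym x y n))
    = log_deriv_series p (\<lambda>m. (\<Sum>l\<le>n. x l ^ m) - (\<Sum>l<n. y l ^ m))
      * comp_series p (alphabet_qsym x y n)"
proof -
  have eq: "(\<lambda>m. x 0 ^ m + ((\<Sum>l<n. x (Suc (0 + l)) ^ m) - (\<Sum>l<n. y (0 + l) ^ m)))
    = (\<lambda>m. (\<Sum>l\<le>n. x l ^ m) - (\<Sum>l<n. y l ^ m))"
    unfolding lessThan_Suc_atMost[symmetric] sum.lessThan_Suc_shift by (simp add: algebra_simps)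
  show ?thesis
    using log_deriv_add_letter[OF log_deriv_pairs_qsym[of p x y n 0], of "x 0"]
    unfolding alphabet_qsym_def eq .
qed

lemma pairs_qsym_Nil [simp]: "pairs_qsym x y n i [] = 1"
  by (induction n arbitrary: i) auto

lemma alphabet_qsym_Nil: "alphabet_qsym x y n [] = 1"
  by (simp add: alphabet_qsym_def)

section \<open>The sign of words in an interlacing alphabet\<close>

text \<open>The factor removes the sign that the pairs produce if the alphabet interlaces, so this will be
nonnegative.\<close>
definition signed_pairs :: "(nat \<Rightarrow> real) \<Rightarrow> (nat \<Rightarrow> real) \<Rightarrow> nat \<Rightarrow> nat \<Rightarrow> nat list \<Rightarrow> real" where
  "signed_pairs x y n i \<alpha> = (- 1) ^ length \<alpha> * pairs_qsym x y n i \<alpha>"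

lemma signed_pairs_rec:
  "signed_pairs x y (Suc n) i (j # \<alpha>) =
     signed_pairs x y n (Suc i) (j # \<alpha>) - x (Suc i) ^ j * signed_pairs x y n (Suc i) \<alpha>
     + y i ^ j * signed_pairs x y (Suc n) i \<alpha>"
  by (simp add: signed_pairs_def algebra_simps)

context
  fixes x y :: "nat \<Rightarrow> real"
  assumes y_pos: "\<And>i. 0 < y i" and y_x: "\<And>i. y i < x i" and x_y: "\<And>i. x (Suc i) < y i"
begin

lemma interlacing_x_pos: "0 < x i"
  using y_pos[of i] y_x[of i] by linarith

lemma signed_pairs_Nil [simp]: "signed_pairs x y n i [] = 1"
  by (simp add: signed_pairs_def)

text \<open>In the recursion for a new pair the term of \<open>y\<^sub>i\<close> outweighs the term of \<open>x\<^bsub>i+1\<^esub>\<close>, because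
\<open>x\<^bsub>i+1\<^esub> < y\<^sub>i\<close>.\<close>
lemma signed_pairs_mono_aux:
  assumes "\<And>\<beta>. 0 \<le> signed_pairs x y n (Suc i) \<beta>"
  shows "signed_pairs x y n (Suc i) \<alpha> \<le> signed_pairs x y (Suc n) i \<alpha>"
proof (induction \<alpha>)
  case (Cons j \<alpha>)
  have "x (Suc i) ^ j * signed_pairs x y n (Suc i) \<alpha> \<le> y i ^ j * signed_pairs x y n (Suc i) \<alpha>"
    using x_y[of i] interlacing_x_pos[of "Suc i"] assms by (intro mult_right_mono power_mono) auto
  also have "\<dots> \<le> y i ^ j * signed_pairs x y (Suc n) i \<alpha>"
    using Cons.IH y_pos[of i] by (intro mult_left_mono) auto
  finally show ?case
    by (simp add: signed_pairs_rec)
qed simp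

text \<open>The second bound is what carries the induction over the pairs: splitting off the first part of a
word costs at most the corresponding power of the largest letter. For the alphabet with a pair
less this power is one of \<open>y\<^bsub>i+1\<^esub> < x\<^bsub>i+1\<^esub>\<close>, so the term of \<open>x\<^bsub>i+1\<^esub>\<close> in the recursion absorbs what is left
of the smaller alphabet.\<close>
lemma signed_pairs_bounds:
  "0 \<le> signed_pairs x y n i \<alpha> \<and> signed_pairs x y n i (j # \<alpha>) \<le> y i ^ j * signed_pairs x y n i \<alpha>"
proof (induction n arbitrary: i \<alpha> j)
  case 0
  show ?case
    using y_pos[of i] by (simp add: signed_pairs_def)
next
  case (Suc n)
  have nonneg: "0 \<le> signed_pairs x y n (Suc i) \<beta>" for \<beta>
    using Suc.IH by blast
  have mono: "signed_pairs x y n (Suc i) \<beta> \<le> signed_pairs x y (Suc n) i \<beta>" for \<beta>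
    using nonneg by (rule signed_pairs_mono_aux)
  have "signed_pairs x y n (Suc i) (j # \<alpha>) \<le> y (Suc i) ^ j * signed_pairs x y n (Suc i) \<alpha>"
    using Suc.IH by blast
  also have "\<dots> \<le> x (Suc i) ^ j * signed_pairs x y n (Suc i) \<alpha>"
    using y_x[of "Suc i"] y_pos[of "Suc i"] nonneg by (intro mult_right_mono power_mono) auto
  finally show ?case
    using nonneg[of \<alpha>] mono[of \<alpha>] by (simp add: signed_pairs_rec)
qed

text \<open>The bound does not involve the number of pairs, so it survives the passage to infinitely many.\<close>
lemma signed_pairs_lower_bound:
  "(\<Prod>j\<leftarrow>\<alpha>. y i ^ j - x (Suc i) ^ j) \<le> signed_pairs x y (Suc n) i \<alpha>"
proof (induction \<alpha>)
  case (Cons j \<alpha>)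
  have nonneg: "0 \<le> signed_pairs x y m l \<beta>" for m l \<beta>
    using signed_pairs_bounds by blast
  have mono: "signed_pairs x y n (Suc i) \<alpha> \<le> signed_pairs x y (Suc n) i \<alpha>"
    using nonneg by (rule signed_pairs_mono_aux)
  have "(y i ^ j - x (Suc i) ^ j) * (\<Prod>j\<leftarrow>\<alpha>. y i ^ j - x (Suc i) ^ j)
    \<le> (y i ^ j - x (Suc i) ^ j) * signed_pairs x y (Suc n) i \<alpha>"
    using Cons.IH x_y[of i] interlacing_x_pos[of "Suc i"] by (intro mult_left_mono) (auto intro: power_mono)
  also have "\<dots> \<le> y i ^ j * signed_pairs x y (Suc n) i \<alpha> - x (Suc i) ^ j * signed_pairs x y n (Suc i) \<alpha>"
    using mono interlacing_x_pos[of "Suc i"] by (simp add: algebra_simps)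
  also have "\<dots> \<le> signed_pairs x y (Suc n) i (j # \<alpha>)"
    using nonneg[of n "Suc i" "j # \<alpha>"] by (simp add: signed_pairs_rec)
  finally show ?case by simp
qed simp

text \<open>A positive lower bound, independent of the number of letters, for the absolute value on \<open>\<alpha>\<close> of the
quasisymmetric functions of the whole alphabet.\<close>
definition sign_gap :: "nat list \<Rightarrow> real" where
  "sign_gap \<alpha> = (x 0 ^ hd \<alpha> - y 0 ^ hd \<alpha>) * (\<Prod>j\<leftarrow>tl \<alpha>. y 0 ^ j - x 1 ^ j)"

lemma sign_gap_pos:
  assumes "0 \<notin> set \<alpha>" "\<alpha> \<noteq> []"
  shows "0 < sign_gap \<alpha>"
proof -
  obtain j \<beta> where \<alpha>: "\<alpha> = j # \<beta>"
    using assms(2) by (cases \<alpha>) auto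
  have "0 < (\<Prod>j\<leftarrow>\<beta>. y 0 ^ j - x 1 ^ j)" if "0 \<notin> set \<beta>"
    using that
  proof (induction \<beta>)
    case (Cons l \<beta>)
    then show ?case
      using x_y[of 0] interlacing_x_pos[of 1] by (auto intro!: mult_pos_pos power_strict_mono)
  qed simp
  moreover have "y 0 ^ j < x 0 ^ j"
    using assms(1) y_x[of 0] y_pos[of 0] by (intro power_strict_mono) (auto simp: \<alpha>)
  ultimately show ?thesis
    using assms(1) by (simp add: sign_gap_def \<alpha>)
qed

text \<open>Putting \<open>x\<^sub>0\<close> in front of the pairs adds a term for the shorter word, of opposite sign. It dominates
because splitting off the first part costs only a power of \<open>y\<^sub>0 < x\<^sub>0\<close>. Hence words of odd length
get a positive sign, although the pairs alone give them a negative one.\<close>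
lemma alphabet_qsym_sign:
  assumes "\<alpha> \<noteq> []" "n > 0"
  shows "sign_gap \<alpha> \<le> - ((- 1) ^ length \<alpha>) * alphabet_qsym x y n \<alpha>"
proof -
  obtain j \<beta> where \<alpha>: "\<alpha> = j # \<beta>"
    using assms(1) by (cases \<alpha>) auto
  obtain m where n: "n = Suc m"
    using assms(2) gr0_conv_Suc by blast
  have "sign_gap \<alpha> \<le> (x 0 ^ j - y 0 ^ j) * signed_pairs x y n 0 \<beta>"
    unfolding sign_gap_def \<alpha> list.sel n
    using signed_pairs_lower_bound[of 0 \<beta> m] y_x[of 0] y_pos[of 0]
    by (intro mult_left_mono) (auto intro: power_mono)
  also have "\<dots> \<le> x 0 ^ j * signed_pairs x y n 0 \<beta> - signed_pairs x y n 0 (j # \<beta>)"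
    using signed_pairs_bounds[of n 0 \<beta> j] by (simp add: algebra_simps)
  also have "\<dots> = - ((- 1) ^ length \<alpha>) * alphabet_qsym x y n \<alpha>"
    by (simp add: alphabet_qsym_def signed_pairs_def \<alpha> algebra_simps)
  finally show ?thesis .
qed

end

section \<open>Coefficients as functions of the power sums\<close>

text \<open>A solution \<open>F\<close> of \<open>t F' = H F\<close> at the level of words, where \<open>H\<close> is the logarithmic derivative
belonging to the sequence \<open>q\<close> of power sums. It makes sense over the rationals and depends continuously
on \<open>q\<close>, although for the power sums of an alphabet it differs from the quasisymmetric functions of
that alphabet: the two agree only after summation over all rearrangements of a word.\<close>
fun log_deriv_solution :: "(nat \<Rightarrow> 'a) \<Rightarrow> nat list \<Rightarrow> 'a::field_char_0" where
  "log_deriv_solution q [] = 1"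
| "log_deriv_solution q (j # \<alpha>) =
     (\<Sum>i\<le>length \<alpha>. power_sum_coeff q (take (Suc i) (j # \<alpha>)) * log_deriv_solution q (drop i \<alpha>))
     / of_nat (sum_list (j # \<alpha>))"

lemma log_deriv_solution_eq:
  assumes "0 \<notin> set \<alpha>"
  shows "of_nat (sum_list \<alpha>) * log_deriv_solution q \<alpha>
    = deconc (power_sum_coeff q) (log_deriv_solution q) \<alpha>"
proof (cases \<alpha>)
  case (Cons j \<beta>)
  have "of_nat (sum_list \<alpha>) \<noteq> (0 :: 'a)"
    using assms by (simp add: Cons flip: of_nat_add)
  then show ?thesis
    unfolding deconc_def Cons length_Cons sum.atMost_Suc_shift
    by (simp add: power_sum_coeff_def)
qed (simp add: deconc_def power_sum_coeff_def)

lemma log_deriv_solution_of_rat: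
  "of_rat (log_deriv_solution q \<alpha>) = log_deriv_solution (\<lambda>n. of_rat (q n)) \<alpha>"
proof (induction "length \<alpha>" arbitrary: \<alpha> rule: less_induct)
  case less
  have c: "of_rat (power_sum_coeff q \<beta>) = power_sum_coeff (\<lambda>n. of_rat (q n)) \<beta>" for \<beta>
    by (simp add: power_sum_coeff_def of_rat_mult of_rat_power of_rat_minus)
  show ?case
    using less by (cases \<alpha>) (auto simp: of_rat_divide of_rat_sum of_rat_mult of_rat_add c intro!: sum.cong)
qed

lemma tendsto_log_deriv_solution:
  fixes q :: "nat \<Rightarrow> real"
  assumes "\<And>n. n > 0 \<Longrightarrow> (\<lambda>N. q' N n) \<longlonglongrightarrow> q n" and "0 \<notin> set \<alpha>"
  shows "(\<lambda>N. log_deriv_solution (q' N) \<alpha>) \<longlonglongrightarrow> log_deriv_solution q \<alpha>"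
  using assms(2)
proof (induction "length \<alpha>" arbitrary: \<alpha> rule: less_induct)
  case less
  show ?case
  proof (cases \<alpha>)
    case (Cons j \<beta>)
    have "(\<lambda>N. power_sum_coeff (q' N) (take (Suc i) \<alpha>)) \<longlonglongrightarrow> power_sum_coeff q (take (Suc i) \<alpha>)" for i
      using less.prems unfolding power_sum_coeff_def Cons
      by (auto intro!: tendsto_intros assms(1))
    moreover have "(\<lambda>N. log_deriv_solution (q' N) (drop i \<beta>)) \<longlonglongrightarrow> log_deriv_solution q (drop i \<beta>)" for i
      using less.prems by (intro less.hyps) (auto simp: Cons dest: in_set_dropD)
    ultimately show ?thesis
      using less.prems unfolding Cons log_deriv_solution.simps
      by (intro tendsto_divide tendsto_sum tendsto_mult tendsto_const) (auto simp flip: of_nat_add)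
  qed simp
qed

abbreviation const_poly :: "'a \<Rightarrow> ('v \<Rightarrow>\<^sub>0 nat) \<Rightarrow>\<^sub>0 'a::comm_ring_1" where
  "const_poly \<equiv> Poly_Mapping.single 0"

lemma const_poly_mult: "const_poly (a * b) = const_poly a * const_poly b"
  by (simp add: mult_single)

lemma const_poly_power: "const_poly (a ^ n) = const_poly a ^ n"
  by (induction n) (simp_all add: const_poly_mult)

lemma const_poly_sum: "const_poly (sum f A) = (\<Sum>a\<in>A. const_poly (f a))"
  by (induction A rule: infinite_finite_induct) (simp_all add: single_add)

lemma const_poly_of_nat: "const_poly (of_nat n) = of_nat n"
  by (induction n) (simp_all add: single_add)

lemma const_poly_power_sum_coeff:
  "const_poly (power_sum_coeff q \<beta>) = power_sum_coeff (\<lambda>n. const_poly (q n)) \<beta>"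
  by (simp add: power_sum_coeff_def const_poly_mult const_poly_power const_poly_of_nat single_uminus)

lemma log_deriv_solution_series:
  "fps_X * fps_deriv (comp_series p (\<lambda>\<alpha>. const_poly (log_deriv_solution q \<alpha>)))
    = log_deriv_series p (\<lambda>n. const_poly (q n)) * comp_series p (\<lambda>\<alpha>. const_poly (log_deriv_solution q \<alpha>))"
  unfolding X_deriv_comp_series comp_series_mult
proof (rule comp_series_cong)
  fix \<alpha> :: "nat list" assume "0 \<notin> set \<alpha>"
  then have "const_poly (of_nat (sum_list \<alpha>) * log_deriv_solution q \<alpha>)
    = const_poly (deconc (power_sum_coeff q) (log_deriv_solution q) \<alpha>)"
    by (intro arg_cong[OF log_deriv_solution_eq])
  then show "of_nat (sum_list \<alpha>) * const_poly (log_deriv_solution q \<alpha>)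
    = deconc (power_sum_coeff (\<lambda>n. const_poly (q n))) (\<lambda>\<alpha>. const_poly (log_deriv_solution q \<alpha>)) \<alpha>"
    by (simp add: deconc_def const_poly_mult const_poly_of_nat const_poly_sum const_poly_power_sum_coeff)
qed

lemma const_poly_add_letter:
  "const_poly (add_letter x M \<alpha>) = add_letter (const_poly x) (\<lambda>\<beta>. const_poly (M \<beta>)) \<alpha>"
  by (cases \<alpha>) (simp_all add: single_add const_poly_mult const_poly_power)

lemma const_poly_remove_letter:
  "const_poly (remove_letter y M \<alpha>) = remove_letter (const_poly y) (\<lambda>\<beta>. const_poly (M \<beta>)) \<alpha>"
  by (induction \<alpha>) (simp_all add: single_diff const_poly_mult const_poly_power)

lemma const_poly_pairs_qsym:
  "const_poly (pairs_qsym x y n i \<alpha>)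
    = pairs_qsym (\<lambda>i. const_poly (x i)) (\<lambda>i. const_poly (y i)) n i \<alpha>"
  by (induction n arbitrary: i \<alpha>) (simp_all add: const_poly_add_letter const_poly_remove_letter)

lemma const_poly_alphabet_qsym:
  "const_poly (alphabet_qsym x y n \<alpha>)
    = alphabet_qsym (\<lambda>i. const_poly (x i)) (\<lambda>i. const_poly (y i)) n \<alpha>"
  by (simp add: alphabet_qsym_def const_poly_add_letter const_poly_pairs_qsym)

text \<open>The indeterminates over an arbitrary coefficient ring; over the rationals they are the indeterminates
of the \<open>L\<close>-polynomials, and over the reals they serve to compare with alphabets of real letters.\<close>
definition variable :: "nat \<Rightarrow> (nat \<Rightarrow>\<^sub>0 nat) \<Rightarrow>\<^sub>0 'a::comm_ring_1" where
  "variable i = Poly_Mapping.single (Poly_Mapping.single i 1) 1"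

lemma prod_list_variable: "prod_list (map variable \<alpha>) = Poly_Mapping.single (index_monomial \<alpha>) 1"
  by (induction \<alpha>) (simp_all add: index_monomial_def variable_def mult_single)

lemma lookup_comp_series_variable:
  "Poly_Mapping.lookup (fps_nth (comp_series variable (\<lambda>\<alpha>. const_poly (f \<alpha>))) k) a
    = (\<Sum>\<alpha> | \<alpha> \<in> compositions k \<and> index_monomial \<alpha> = a. f \<alpha>)"
  by (simp add: comp_series_nth lookup_sum prod_list_variable mult_single lookup_single when_def
      sum.inter_filter)

text \<open>Both families of word coefficients solve the same differential equation once the letters
\<open>p\<^sub>i\<close> commute, so they give the same polynomials; the sums here are the coefficients of one monomial
in them.\<close>
lemma symmetrized_coeffs_eq:
  fixes x y :: "nat \<Rightarrow> 'a::field_char_0"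
  shows "(\<Sum>\<alpha> | \<alpha> \<in> compositions k \<and> index_monomial \<alpha> = a.
      log_deriv_solution (\<lambda>m. (\<Sum>l\<le>n. x l ^ m) - (\<Sum>l<n. y l ^ m)) \<alpha>)
    = (\<Sum>\<alpha> | \<alpha> \<in> compositions k \<and> index_monomial \<alpha> = a. alphabet_qsym x y n \<alpha>)"
proof -
  let ?q = "\<lambda>m. (\<Sum>l\<le>n. x l ^ m) - (\<Sum>l<n. y l ^ m)"
  let ?p = "variable :: nat \<Rightarrow> (nat \<Rightarrow>\<^sub>0 nat) \<Rightarrow>\<^sub>0 'a"
  have q: "(\<Sum>l\<le>n. const_poly (x l) ^ m) - (\<Sum>l<n. const_poly (y l) ^ m) = const_poly (?q m)" for m
    by (simp add: single_diff const_poly_sum const_poly_power)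
  have "comp_series ?p (\<lambda>\<alpha>. const_poly (log_deriv_solution ?q \<alpha>))
    = comp_series ?p (\<lambda>\<alpha>. const_poly (alphabet_qsym x y n \<alpha>))"
  proof (rule log_deriv_unique)
    show "fps_X * fps_deriv (comp_series ?p (\<lambda>\<alpha>. const_poly (log_deriv_solution ?q \<alpha>)))
      = log_deriv_series ?p (\<lambda>n. const_poly (?q n)) * comp_series ?p (\<lambda>\<alpha>. const_poly (log_deriv_solution ?q \<alpha>))"
      by (rule log_deriv_solution_series)
    show "fps_X * fps_deriv (comp_series ?p (\<lambda>\<alpha>. const_poly (alphabet_qsym x y n \<alpha>)))
      = log_deriv_series ?p (\<lambda>n. const_poly (?q n)) * comp_series ?p (\<lambda>\<alpha>. const_poly (alphabet_qsym x y n \<alpha>))"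
      unfolding const_poly_alphabet_qsym log_deriv_alphabet_qsym q ..
  qed (simp_all add: comp_series_nth alphabet_qsym_Nil power_sum_coeff_def)
  then show ?thesis
    by (simp only: flip: lookup_comp_series_variable)
qed

section \<open>Algebraic independence of the elementary symmetric polynomials\<close>

text \<open>The leading coefficient is required to be one. Monomials are compared lexicographically, small
indices being the most significant.\<close>
definition leading :: "((nat \<Rightarrow>\<^sub>0 nat) \<Rightarrow>\<^sub>0 'a::comm_ring_1) \<Rightarrow> (nat \<Rightarrow>\<^sub>0 nat) \<Rightarrow> bool" where
  "leading P a \<longleftrightarrow> (\<forall>b\<in>Poly_Mapping.keys (P - Poly_Mapping.single a 1). b < a)"

lemma leading_lookup: "leading P a \<Longrightarrow> Poly_Mapping.lookup P a = 1"
  by (auto simp: leading_def in_keys_iff lookup_minus)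

lemma leading_lookup_0:
  assumes "leading P a" "a < b"
  shows "Poly_Mapping.lookup P b = 0"
proof (rule ccontr)
  assume "Poly_Mapping.lookup P b \<noteq> 0"
  with assms(2) have "b \<in> Poly_Mapping.keys (P - Poly_Mapping.single a 1)"
    by (simp add: in_keys_iff lookup_minus lookup_single)
  with assms show False
    by (auto simp: leading_def)
qed

lemma leading_1: "leading 1 0"
  by (simp add: leading_def)

lemma leading_mult:
  assumes P: "leading P a" and Q: "leading Q b"
  shows "leading (P * Q) (a + b)"
  unfolding leading_def
proof
  let ?p = "Poly_Mapping.single a 1 :: (nat \<Rightarrow>\<^sub>0 nat) \<Rightarrow>\<^sub>0 'a"
  let ?q = "Poly_Mapping.single b 1 :: (nat \<Rightarrow>\<^sub>0 nat) \<Rightarrow>\<^sub>0 'a"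
  fix c assume "c \<in> Poly_Mapping.keys (P * Q - Poly_Mapping.single (a + b) 1)"
  moreover have "P * Q - Poly_Mapping.single (a + b) 1
    = (P - ?p) * (Q - ?q) + ((P - ?p) * ?q + ?p * (Q - ?q))"
    by (simp add: algebra_simps mult_single)
  ultimately have "c \<in> Poly_Mapping.keys ((P - ?p) * (Q - ?q))
      \<union> (Poly_Mapping.keys ((P - ?p) * ?q) \<union> Poly_Mapping.keys (?p * (Q - ?q)))"
    using keys_add[of "(P - ?p) * (Q - ?q)" "(P - ?p) * ?q + ?p * (Q - ?q)"]
      keys_add[of "(P - ?p) * ?q" "?p * (Q - ?q)"] by auto
  then consider "c \<in> Poly_Mapping.keys ((P - ?p) * (Q - ?q))" | "c \<in> Poly_Mapping.keys ((P - ?p) * ?q)"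
    | "c \<in> Poly_Mapping.keys (?p * (Q - ?q))"
    by blast
  then show "c < a + b"
  proof cases
    case 1
    then obtain u v where "c = u + v" "u \<in> Poly_Mapping.keys (P - ?p)" "v \<in> Poly_Mapping.keys (Q - ?q)"
      using keys_mult[of "P - ?p" "Q - ?q"] by blast
    with P Q show ?thesis
      by (auto simp: leading_def intro: add_strict_mono)
  next
    case 2
    then obtain u v where "c = u + v" "u \<in> Poly_Mapping.keys (P - ?p)" "v \<in> Poly_Mapping.keys ?q"
      using keys_mult[of "P - ?p" ?q] by blast
    with P show ?thesis
      by (auto simp: leading_def intro: add_strict_right_mono split: if_splits)
  next
    case 3
    then obtain u v where "c = u + v" "u \<in> Poly_Mapping.keys ?p" "v \<in> Poly_Mapping.keys (Q - ?q)"
      using keys_mult[of ?p "Q - ?q"] by blast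
    with Q show ?thesis
      by (auto simp: leading_def intro: add_strict_left_mono split: if_splits)
  qed
qed

lemma leading_prod:
  "(\<And>i. i \<in> I \<Longrightarrow> leading (P i) (a i)) \<Longrightarrow> leading (\<Prod>i\<in>I. P i) (\<Sum>i\<in>I. a i)"
  by (induction I rule: infinite_finite_induct) (auto simp: leading_1 leading_mult)

lemma leading_power: "leading P a \<Longrightarrow> leading (P ^ n) (\<Sum>i<n. a)"
  using leading_prod[of "{..<n}" "\<lambda>_. P" "\<lambda>_. a"] by simp

definition set_monomial :: "nat set \<Rightarrow> nat \<Rightarrow>\<^sub>0 nat" where
  "set_monomial S = (\<Sum>j\<in>S. Poly_Mapping.single j 1)"

lemma lookup_set_monomial:
  "finite S \<Longrightarrow> Poly_Mapping.lookup (set_monomial S) j = of_bool (j \<in> S)"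
  by (auto simp: set_monomial_def lookup_sum lookup_single when_def)

lemma prod_mp_var: "finite S \<Longrightarrow> (\<Prod>j\<in>S. mp_var j) = Poly_Mapping.single (set_monomial S) 1"
  by (induction S rule: finite_induct) (simp_all add: set_monomial_def mp_var_def mult_single)

text \<open>The two sets agree below the smallest element of \<open>{1..i}\<close> that is missing in \<open>S\<close>.\<close>
lemma set_monomial_less:
  assumes "S \<subseteq> {1..m}" "card S = i" "S \<noteq> {1..i}"
  shows "set_monomial S < set_monomial {1..i}"
proof -
  have fin: "finite S"
    using assms(1) finite_subset by blast
  have ne: "{1..i} - S \<noteq> {}"
    using card_subset_eq[OF fin, of "{1..i}"] assms(2,3) by auto
  define k where "k = Min ({1..i} - S)"
  have k: "k \<in> {1..i} - S"
    unfolding k_def using ne by (intro Min_in) auto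
  have "l \<in> S \<longleftrightarrow> l \<in> {1..i}" if "l < k" for l
  proof -
    have "l \<notin> {1..i} - S"
    proof
      assume "l \<in> {1..i} - S"
      then have "k \<le> l"
        unfolding k_def by (intro Min_le) auto
      with that show False by simp
    qed
    then show ?thesis
      using that k assms(1) by auto
  qed
  with k fin show ?thesis
    unfolding less_poly_mapping.rep_eq less_fun_def
    by (intro exI[of _ k]) (auto simp: lookup_set_monomial)
qed

lemma leading_elem_sym:
  assumes "i \<le> m"
  shows "leading (elem_sym m i) (set_monomial {1..i})"
proof -
  let ?A = "{S. S \<subseteq> {1..m} \<and> card S = i}"
  have fin: "finite ?A" "\<And>S. S \<in> ?A \<Longrightarrow> finite S"
    by (auto intro: finite_subset)
  have "elem_sym m i = (\<Sum>S\<in>?A. Poly_Mapping.single (set_monomial S) 1)"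
    unfolding elem_sym_def using fin(2) by (intro sum.cong) (auto simp: prod_mp_var)
  also have "\<dots> = Poly_Mapping.single (set_monomial {1..i}) 1
      + (\<Sum>S\<in>?A - {{1..i}}. Poly_Mapping.single (set_monomial S) 1)"
    using assms by (intro sum.remove fin) auto
  finally have eq: "elem_sym m i - Poly_Mapping.single (set_monomial {1..i}) 1
    = (\<Sum>S\<in>?A - {{1..i}}. Poly_Mapping.single (set_monomial S) 1)"
    by simp
  show ?thesis
    unfolding leading_def eq
  proof
    fix b assume "b \<in> Poly_Mapping.keys (\<Sum>S\<in>?A - {{1..i}}. Poly_Mapping.single (set_monomial S) (1::rat))"
    then have "(\<Sum>S\<in>?A - {{1..i}}. Poly_Mapping.lookup (Poly_Mapping.single (set_monomial S) (1::rat)) b) \<noteq> 0"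
      by (simp add: in_keys_iff lookup_sum)
    then obtain S where "S \<in> ?A - {{1..i}}" "Poly_Mapping.lookup (Poly_Mapping.single (set_monomial S) (1::rat)) b \<noteq> 0"
      by (rule sum.not_neutral_contains_not_neutral)
    then show "b < set_monomial {1..i}"
      using set_monomial_less[of S m i] by (auto simp: lookup_single when_def split: if_splits)
  qed
qed

definition monomial_subst :: "(nat \<Rightarrow> rat_mpoly) \<Rightarrow> (nat \<Rightarrow>\<^sub>0 nat) \<Rightarrow> rat_mpoly" where
  "monomial_subst f a = (\<Prod>i\<in>Poly_Mapping.keys a. f i ^ Poly_Mapping.lookup a i)"

lemma lookup_mp_const_mult: "Poly_Mapping.lookup (mp_const c * P) a = c * Poly_Mapping.lookup P a"
  unfolding mp_const_def mult_map_scale_conv_mult[symmetric]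
  by (simp add: Poly_Mapping.map.rep_eq when_def)

lemma mp_subst_superset:
  assumes "finite A" "Poly_Mapping.keys P \<subseteq> A"
  shows "mp_subst f P = (\<Sum>a\<in>A. mp_const (Poly_Mapping.lookup P a) * monomial_subst f a)"
  unfolding mp_subst_def mp_coeff_def monomial_subst_def
  by (rule sum.mono_neutral_left) (use assms in \<open>auto simp: mp_const_def in_keys_iff\<close>)

lemma mp_subst_add: "mp_subst f (P + Q) = mp_subst f P + mp_subst f Q"
proof -
  let ?A = "Poly_Mapping.keys P \<union> Poly_Mapping.keys Q"
  have "mp_subst f (P + Q) = (\<Sum>a\<in>?A. mp_const (Poly_Mapping.lookup (P + Q) a) * monomial_subst f a)"
    by (rule mp_subst_superset) (auto simp: keys_add)
  also have "\<dots> = (\<Sum>a\<in>?A. mp_const (Poly_Mapping.lookup P a) * monomial_subst f a)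
      + (\<Sum>a\<in>?A. mp_const (Poly_Mapping.lookup Q a) * monomial_subst f a)"
    by (simp add: lookup_add mp_const_def single_add algebra_simps sum.distrib)
  also have "\<dots> = mp_subst f P + mp_subst f Q"
    by (simp add: mp_subst_superset[of ?A])
  finally show ?thesis .
qed

lemma mp_subst_single: "mp_subst f (Poly_Mapping.single a c) = mp_const c * monomial_subst f a"
  by (simp add: mp_subst_superset[of "{a}"])

lemma mp_subst_sum: "mp_subst f (sum P A) = (\<Sum>a\<in>A. mp_subst f (P a))"
  by (induction A rule: infinite_finite_induct) (simp_all add: mp_subst_add mp_subst_superset[of "{}"])

text \<open>The leading monomial of a product of elementary symmetric polynomials: on partitions, this is
conjugation.\<close>
definition conj_monomial :: "(nat \<Rightarrow>\<^sub>0 nat) \<Rightarrow> nat \<Rightarrow>\<^sub>0 nat" where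
  "conj_monomial a = (\<Sum>i\<in>Poly_Mapping.keys a. \<Sum>l<Poly_Mapping.lookup a i. set_monomial {1..i})"

lemma lookup_conj_monomial:
  "j \<ge> 1 \<Longrightarrow> Poly_Mapping.lookup (conj_monomial a) j = (\<Sum>i\<in>Poly_Mapping.keys a. if j \<le> i then Poly_Mapping.lookup a i else 0)"
  unfolding conj_monomial_def lookup_sum[of _ "Poly_Mapping.keys a"]
  by (intro sum.cong) (auto simp: lookup_sum lookup_set_monomial simp del: sum_constant)

text \<open>The exponents of \<open>a\<close> are the successive differences of the exponents of its conjugate.\<close>
lemma conj_monomial_inj:
  assumes "0 \<notin> Poly_Mapping.keys a" "0 \<notin> Poly_Mapping.keys b" "conj_monomial a = conj_monomial b"
  shows "a = b"
proof (rule poly_mapping_eqI)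
  have step: "Poly_Mapping.lookup (conj_monomial c) j =
    Poly_Mapping.lookup (conj_monomial c) (Suc j) + Poly_Mapping.lookup c j"
    if "j \<ge> 1" for c j
  proof -
    have "Poly_Mapping.lookup (conj_monomial c) j
      = (\<Sum>i\<in>Poly_Mapping.keys c. (if Suc j \<le> i then Poly_Mapping.lookup c i else 0)
          + (if i = j then Poly_Mapping.lookup c j else 0))"
      using that by (simp add: lookup_conj_monomial) (intro sum.cong, auto)
    then show ?thesis
      by (simp add: lookup_conj_monomial sum.distrib in_keys_iff)
  qed
  fix j show "Poly_Mapping.lookup a j = Poly_Mapping.lookup b j"
  proof (cases "j = 0")
    case False
    then show ?thesis
      using step[of j a] step[of j b] assms(3) by simp
  qed (use assms in \<open>simp add: in_keys_iff\<close>)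
qed

text \<open>Distinct monomials have distinct leading monomials after substitution, so the largest of them
cannot cancel.\<close>
lemma elem_sym_independent:
  assumes vars: "mp_vars P \<subseteq> {1..k}" and 0: "mp_subst (elem_sym k) P = 0"
  shows "P = 0"
proof (rule ccontr)
  assume "P \<noteq> 0"
  then have "Max (conj_monomial ` Poly_Mapping.keys P) \<in> conj_monomial ` Poly_Mapping.keys P"
    by (intro Max_in) auto
  then obtain a where a: "a \<in> Poly_Mapping.keys P" and "conj_monomial a = Max (conj_monomial ` Poly_Mapping.keys P)"
    by (metis imageE)
  then have max: "conj_monomial b \<le> conj_monomial a" if "b \<in> Poly_Mapping.keys P" for b
    using that by simp
  have supp: "Poly_Mapping.keys b \<subseteq> {1..k}" if "b \<in> Poly_Mapping.keys P" for b
    using vars that by (auto simp: mp_vars_def)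
  have lead: "leading (monomial_subst (elem_sym k) b) (conj_monomial b)" if "b \<in> Poly_Mapping.keys P" for b
    unfolding monomial_subst_def conj_monomial_def
    using supp[OF that] by (intro leading_prod leading_power leading_elem_sym) auto
  have "Poly_Mapping.lookup (mp_subst (elem_sym k) P) (conj_monomial a)
    = (\<Sum>b\<in>Poly_Mapping.keys P. Poly_Mapping.lookup P b * Poly_Mapping.lookup (monomial_subst (elem_sym k) b) (conj_monomial a))"
    by (simp add: mp_subst_superset[of "Poly_Mapping.keys P"] lookup_sum lookup_mp_const_mult)
  also have "\<dots> = (\<Sum>b\<in>Poly_Mapping.keys P. if b = a then Poly_Mapping.lookup P a else 0)"
  proof (rule sum.cong)
    fix b assume b: "b \<in> Poly_Mapping.keys P"
    show "Poly_Mapping.lookup P b * Poly_Mapping.lookup (monomial_subst (elem_sym k) b) (conj_monomial a)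
      = (if b = a then Poly_Mapping.lookup P a else 0)"
    proof (cases "b = a")
      case False
      then have "conj_monomial b \<noteq> conj_monomial a"
        using conj_monomial_inj[of b a] supp[OF a, THEN subsetD, of 0] supp[OF b, THEN subsetD, of 0] by auto
      with max[OF b] have "conj_monomial b < conj_monomial a"
        by simp
      with lead[OF b] False show ?thesis
        by (simp add: leading_lookup_0)
    qed (use lead[OF a] in \<open>simp add: leading_lookup\<close>)
  qed simp
  also have "\<dots> = Poly_Mapping.lookup P a"
    using a by simp
  finally show False
    using a 0 by (simp add: in_keys_iff)
qed

section \<open>The L-polynomials as a sum over compositions\<close>

text \<open>The series of \<open>sinh \<surd>z / \<surd>z\<close>.\<close>
definition fps_sinhc :: "'a::field_char_0 fps" where
  "fps_sinhc = Abs_fps (\<lambda>n. 1 / fact (2 * n + 1))"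

definition fps_cosh_sqrt :: "'a::field_char_0 fps" where
  "fps_cosh_sqrt = Abs_fps (\<lambda>n. 1 / fact (2 * n))"

text \<open>This is \<open>(w / tanh w) sinh w = w cosh w\<close> after division by \<open>w\<close> and with \<open>w\<^sup>2\<close> replaced by \<open>z\<close>.\<close>
lemma hirzebruch_Q_mult_sinhc: "hirzebruch_Q * fps_sinhc = fps_cosh_sqrt"
proof (rule fps_ext)
  fix n
  let ?s = "fps_exp 1 - fps_exp (- 1) :: rat fps"
  let ?c = "fps_exp 1 + fps_exp (- 1) :: rat fps"
  have even_pow: "fps_nth (fps_X ^ 2 :: rat fps) 0 = 0" by simp
  have comp: "fps_nth (f oo fps_X ^ 2) m = (if even m then fps_nth f (m div 2) else 0)" for f :: "rat fps" and m
  proof -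
    have "fps_nth (f oo fps_X ^ 2) m = (\<Sum>i=0..m. if i = m div 2 \<and> even m then fps_nth f i else 0)"
      unfolding fps_compose_nth by (intro sum.cong) (auto simp flip: power_mult)
    then show ?thesis by auto
  qed
  have s: "?s = fps_const 2 * (fps_X * (fps_sinhc oo fps_X ^ 2))"
    by (rule fps_ext) (auto simp: comp fps_sinhc_def elim!: oddE)
  have c: "?c = fps_const 2 * (fps_cosh_sqrt oo fps_X ^ 2)"
    by (rule fps_ext) (auto simp: comp fps_cosh_sqrt_def elim!: evenE)
  have "(fps_X / fps_tanh) * ?s = fps_X * ?c"
    using fps_X_div_tanh_mult fps_tanh_mult by (metis mult.assoc)
  then have "fps_const 2 * fps_X * ((hirzebruch_Q * fps_sinhc) oo fps_X ^ 2)
    = fps_const 2 * fps_X * (fps_cosh_sqrt oo fps_X ^ 2)"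
    unfolding s c hirzebruch_Q_square[symmetric]
    by (simp add: fps_compose_mult_distrib[OF even_pow] mult_ac)
  moreover have "fps_const 2 * fps_X \<noteq> (0 :: rat fps)"
    by simp
  ultimately have "(hirzebruch_Q * fps_sinhc) oo fps_X ^ 2 = fps_cosh_sqrt oo fps_X ^ 2"
    by (metis mult_left_cancel)
  then have "fps_nth ((hirzebruch_Q * fps_sinhc) oo fps_X ^ 2) (2 * n) = fps_nth (fps_cosh_sqrt oo fps_X ^ 2) (2 * n)"
    by simp
  then show "fps_nth (hirzebruch_Q * fps_sinhc) n = fps_nth fps_cosh_sqrt n"
    by (simp only: comp) simp
qed

lemma hirzebruch_Q_nth_0: "fps_nth hirzebruch_Q 0 = 1"
  using arg_cong[OF hirzebruch_Q_mult_sinhc, of "\<lambda>f. fps_nth f 0"]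
  by (simp add: fps_sinhc_def fps_cosh_sqrt_def)

text \<open>The signs are chosen such that for \<open>f = \<Prod>(1 + x\<^sub>i z)\<close> these are the power sums \<open>\<Sum> x\<^sub>i\<^sup>n\<close>. For a
quotient of two such products they are the differences of the power sums of the negative inverse
zeros and of the negative inverse poles.\<close>
definition log_deriv_coeff :: "'a::field fps \<Rightarrow> nat \<Rightarrow> 'a" where
  "log_deriv_coeff f n = (- 1) ^ (n - 1) * fps_nth (fps_X * fps_deriv f / f) n"

abbreviation alternating :: "(nat \<Rightarrow> 'a) \<Rightarrow> 'a::comm_ring_1 fps" where
  "alternating q \<equiv> Abs_fps (\<lambda>n. if n = 0 then 0 else (- 1) ^ (n - 1) * q n)"

lemma log_deriv_coeff_eq:
  assumes "fps_nth f 0 \<noteq> 0"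
  shows "fps_X * fps_deriv f = alternating (log_deriv_coeff f) * f"
proof -
  have "alternating (log_deriv_coeff f) = fps_X * fps_deriv f / f"
    using assms by (intro fps_ext) (auto simp: log_deriv_coeff_def fps_divide_unit simp flip: power_add)
  with assms show ?thesis
    by (simp add: fps_divide_unit mult.assoc inverse_mult_eq_1)
qed

lemma log_deriv_prod:
  assumes "\<And>i. i \<in> I \<Longrightarrow> fps_X * fps_deriv (F i) = A i * F i"
  shows "fps_X * fps_deriv (\<Prod>i\<in>I. F i) = (\<Sum>i\<in>I. A i) * (\<Prod>i\<in>I. (F i :: 'a::comm_ring_1 fps))"
  using assms
proof (induction I rule: infinite_finite_induct)
  case (insert i I)
  then have "fps_X * fps_deriv (\<Prod>i\<in>insert i I. F i)
    = (fps_X * fps_deriv (F i)) * prod F I + F i * (fps_X * fps_deriv (prod F I))"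
    by (simp only: prod.insert[OF insert.hyps] fps_deriv_mult) (simp only: algebra_simps)
  also have "fps_X * fps_deriv (prod F I) = sum A I * prod F I"
    using insert by blast
  also have "fps_X * fps_deriv (F i) = A i * F i"
    using insert by blast
  finally show ?case
    by (simp only: prod.insert[OF insert.hyps] sum.insert[OF insert.hyps]) (simp only: algebra_simps)
qed auto

lemma log_deriv_linear:
  fixes x :: "'a::idom"
  shows "fps_X * fps_deriv (1 + fps_const x * fps_X) = alternating (\<lambda>n. x ^ n) * (1 + fps_const x * fps_X)"
proof (rule fps_ext)
  fix n
  let ?A = "alternating (\<lambda>n. x ^ n)"
  have "?A * (1 + fps_const x * fps_X) = ?A + (?A * fps_const x) * fps_X"
    by (simp only: distrib_left mult_1_right mult.assoc)
  moreover have "fps_nth (fps_X * fps_deriv (1 + fps_const x * fps_X)) n = (if n = 1 then x else 0)"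
    by (cases n) auto
  ultimately show "fps_nth (fps_X * fps_deriv (1 + fps_const x * fps_X)) n
    = fps_nth (?A * (1 + fps_const x * fps_X)) n"
    by (cases n; cases "n - 1") auto
qed

lemma alternating_sum: "(\<Sum>i\<in>I. alternating (q i)) = alternating (\<lambda>n. \<Sum>i\<in>I. q i n)"
  by (rule fps_ext) (auto simp: fps_sum_nth sum_distrib_left)

lemma log_deriv_prod_linear:
  fixes x :: "'b \<Rightarrow> 'a::idom"
  shows "fps_X * fps_deriv (\<Prod>i\<in>I. 1 + fps_const (x i) * fps_X)
    = alternating (\<lambda>n. \<Sum>i\<in>I. x i ^ n) * (\<Prod>i\<in>I. 1 + fps_const (x i) * fps_X)"
  by (subst log_deriv_prod[OF log_deriv_linear]) (simp add: alternating_sum)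

lemma fps_const_prod: "fps_const (\<Prod>i\<in>I. c i :: 'a::comm_ring_1) = (\<Prod>i\<in>I. fps_const (c i))"
  by (induction I rule: infinite_finite_induct) (simp_all flip: fps_const_mult)

lemma elem_sym_series:
  "comp_series (elem_sym m) (letter 1) = (\<Prod>i\<in>{1..m}. 1 + fps_const (mp_var i) * fps_X)"
proof (rule fps_ext)
  fix n
  have "(\<Prod>i\<in>{1..m}. fps_const (mp_var i) * fps_X + 1)
    = (\<Sum>S\<in>Pow {1..m}. (\<Prod>i\<in>S. fps_const (mp_var i) * fps_X) * (\<Prod>i\<in>{1..m} - S. 1))"
    by (rule prod_add) simp
  also have "\<dots> = (\<Sum>S\<in>Pow {1..m}. fps_const (\<Prod>i\<in>S. mp_var i) * fps_X ^ card S)"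
    by (intro sum.cong) (auto simp: prod.distrib fps_const_prod)
  finally have "fps_nth (\<Prod>i\<in>{1..m}. 1 + fps_const (mp_var i) * fps_X) n
    = (\<Sum>S\<in>Pow {1..m}. if card S = n then \<Prod>i\<in>S. mp_var i else 0)"
    by (simp add: add.commute fps_sum_nth) (intro sum.cong, auto)
  also have "\<dots> = elem_sym m n"
    unfolding elem_sym_def by (simp add: sum.inter_filter[symmetric] Pow_def)
  finally have "fps_nth (\<Prod>i\<in>{1..m}. 1 + fps_const (mp_var i) * fps_X) n = elem_sym m n" .
  moreover have "elem_sym m 0 = 1"
  proof -
    have "{S. S \<subseteq> {1..m} \<and> card S = 0} = {{}}"
      by (auto dest: finite_subset)
    then show ?thesis unfolding elem_sym_def by simp
  qed
  ultimately show "fps_nth (comp_series (elem_sym m) (letter 1)) n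
    = fps_nth (\<Prod>i\<in>{1..m}. 1 + fps_const (mp_var i) * fps_X) n"
    by (simp add: comp_series_letter_nth)
qed

text \<open>If the letters \<open>p\<^sub>i\<close> are replaced by elementary symmetric polynomials, then \<open>E(t)\<close> becomes
\<open>\<Prod>(1 + x\<^sub>i t)\<close>, so its logarithmic derivative is the generating series of the power sums
(this is Newton's identity).\<close>
lemma log_deriv_elem_sym:
  "log_deriv_series (elem_sym m) q = alternating (\<lambda>n. q n * (\<Sum>i\<in>{1..m}. mp_var i ^ n))"
proof -
  let ?E = "\<Prod>i\<in>{1..m}. 1 + fps_const (mp_var i) * fps_X"
  have "log_deriv_series (elem_sym m) (\<lambda>n. 1 ^ n) * ?E = alternating (\<lambda>n. \<Sum>i\<in>{1..m}. mp_var i ^ n) * ?E"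
    using letter_series_deriv[of "elem_sym m" 1] log_deriv_prod_linear[of mp_var "{1..m}"]
    unfolding elem_sym_series by simp
  moreover have "fps_nth ?E 0 = 1"
    unfolding elem_sym_series[symmetric] by (simp add: comp_series_letter_nth)
  then have "?E \<noteq> 0"
    by auto
  ultimately have "log_deriv_series (elem_sym m) (\<lambda>n. 1) = alternating (\<lambda>n. \<Sum>i\<in>{1..m}. mp_var i ^ n)"
    by simp
  then show ?thesis
    by (intro fps_ext) (simp add: log_deriv_series_nth[of _ q])
qed

lemma log_deriv_Q_at_var:
  "fps_X * fps_deriv (Q_at_var i)
    = alternating (\<lambda>n. mp_const (log_deriv_coeff hirzebruch_Q n) * mp_var i ^ n) * Q_at_var i"
proof (rule fps_ext)
  fix n
  let ?q = "log_deriv_coeff hirzebruch_Q"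
  have alt: "(if l = 0 then 0 else (- 1) ^ (l - 1) * (mp_const (?q l) * z))
    = mp_const (fps_nth (alternating ?q) l) * z" for l z
    by (simp add: mp_const_def const_poly_mult const_poly_power single_uminus mult.assoc)
  have "fps_nth (fps_X * fps_deriv (Q_at_var i)) n
    = mp_const (fps_nth (fps_X * fps_deriv hirzebruch_Q) n) * mp_var i ^ n"
    by (cases n) (simp_all add: Q_at_var_def mp_const_def const_poly_mult single_add const_poly_of_nat algebra_simps)
  also have "\<dots> = mp_const (fps_nth (alternating ?q * hirzebruch_Q) n) * mp_var i ^ n"
    by (simp only: log_deriv_coeff_eq hirzebruch_Q_nth_0 one_neq_zero not_False_eq_True)
  also have "\<dots> = (\<Sum>l=0..n. mp_const (fps_nth (alternating ?q) l) * mp_var i ^ l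
      * (mp_const (fps_nth hirzebruch_Q (n - l)) * mp_var i ^ (n - l)))"
    unfolding fps_mult_nth mp_const_def const_poly_sum sum_distrib_right const_poly_mult
    by (intro sum.cong) (auto simp: mult_ac simp flip: power_add)
  also have "\<dots> = fps_nth (alternating (\<lambda>n. mp_const (?q n) * mp_var i ^ n) * Q_at_var i) n"
    unfolding fps_mult_nth Q_at_var_def fps_nth_Abs_fps alt ..
  finally show "fps_nth (fps_X * fps_deriv (Q_at_var i)) n
    = fps_nth (alternating (\<lambda>n. mp_const (?q n) * mp_var i ^ n) * Q_at_var i) n" .
qed

text \<open>A polynomial for which the defining property of the \<open>L\<close>-polynomial can be checked, and whose
coefficients can be compared with those coming from real alphabets.\<close>
definition explicit_L :: "nat \<Rightarrow> rat_mpoly" where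
  "explicit_L k = fps_nth (comp_series variable
     (\<lambda>\<alpha>. const_poly (log_deriv_solution (log_deriv_coeff hirzebruch_Q) \<alpha>))) k"

text \<open>Both sides have the logarithmic derivative \<open>\<Sum>\<^sub>n (-1)\<^bsup>n-1\<^esup> q\<^sub>n (x\<^sub>1\<^sup>n + \<dots> + x\<^sub>m\<^sup>n) t\<^sup>n\<close>, where \<open>q\<^sub>n\<close> are the power
sums of the virtual alphabet of \<open>Q\<close>: on the left the sum over the variables comes from
Newton's identity, on the right from the factors \<open>Q(x\<^sub>i t)\<close>.\<close>
lemma elem_sym_series_Q:
  "comp_series (elem_sym m) (\<lambda>\<alpha>. const_poly (log_deriv_solution (log_deriv_coeff hirzebruch_Q) \<alpha>))
    = (\<Prod>i\<in>{1..m}. Q_at_var i)"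
proof (rule log_deriv_unique)
  let ?q = "log_deriv_coeff hirzebruch_Q"
  let ?H = "log_deriv_series (elem_sym m) (\<lambda>n. const_poly (?q n))"
  show "fps_X * fps_deriv (comp_series (elem_sym m) (\<lambda>\<alpha>. const_poly (log_deriv_solution ?q \<alpha>)))
    = ?H * comp_series (elem_sym m) (\<lambda>\<alpha>. const_poly (log_deriv_solution ?q \<alpha>))"
    by (rule log_deriv_solution_series)
  have "?H = (\<Sum>i\<in>{1..m}. alternating (\<lambda>n. mp_const (?q n) * mp_var i ^ n))"
    unfolding log_deriv_elem_sym alternating_sum mp_const_def sum_distrib_left ..
  then show "fps_X * fps_deriv (\<Prod>i\<in>{1..m}. Q_at_var i) = ?H * (\<Prod>i\<in>{1..m}. Q_at_var i)"
    by (simp only: log_deriv_prod[OF log_deriv_Q_at_var])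
  have "fps_nth (\<Prod>i\<in>I. Q_at_var i) 0 = 1" for I
    by (induction I rule: infinite_finite_induct)
      (auto simp: Q_at_var_def hirzebruch_Q_nth_0 mp_const_def)
  then show "fps_nth (comp_series (elem_sym m) (\<lambda>\<alpha>. const_poly (log_deriv_solution ?q \<alpha>))) 0
    = fps_nth (\<Prod>i\<in>{1..m}. Q_at_var i) 0"
    by (simp add: comp_series_nth)
qed simp

lemma monomial_subst_superset:
  "finite A \<Longrightarrow> Poly_Mapping.keys a \<subseteq> A \<Longrightarrow> monomial_subst f a = (\<Prod>i\<in>A. f i ^ Poly_Mapping.lookup a i)"
  unfolding monomial_subst_def by (rule prod.mono_neutral_left) (auto simp: in_keys_iff)

lemma monomial_subst_add: "monomial_subst f (a + b) = monomial_subst f a * monomial_subst f b"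
  by (simp add: monomial_subst_superset[of "Poly_Mapping.keys a \<union> Poly_Mapping.keys b"]
      keys_add lookup_add power_add prod.distrib)

lemma monomial_subst_index_monomial: "monomial_subst f (index_monomial \<alpha>) = prod_list (map f \<alpha>)"
  by (induction \<alpha>) (simp_all add: index_monomial_def monomial_subst_add,
      simp_all add: monomial_subst_def)

lemma mp_subst_explicit_L: "mp_subst (elem_sym m) (explicit_L k) = Q_product_part m k"
  unfolding explicit_L_def Q_product_part_def elem_sym_series_Q[symmetric]
  by (simp add: comp_series_nth mp_subst_sum prod_list_variable mult_single mp_subst_single
      monomial_subst_index_monomial mp_const_def)

lemma mp_vars_explicit_L: "mp_vars (explicit_L k) \<subseteq> {1..k}"
proof
  fix i assume "i \<in> mp_vars (explicit_L k)"
  then obtain a where a: "a \<in> Poly_Mapping.keys (explicit_L k)" and i: "i \<in> Poly_Mapping.keys a"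
    by (auto simp: mp_vars_def)
  from a have "{\<alpha>. \<alpha> \<in> compositions k \<and> index_monomial \<alpha> = a} \<noteq> {}"
    unfolding in_keys_iff explicit_L_def lookup_comp_series_variable by (metis sum.empty)
  then obtain \<alpha> where \<alpha>: "\<alpha> \<in> compositions k" "index_monomial \<alpha> = a"
    by blast
  have "Poly_Mapping.keys (index_monomial \<beta>) \<subseteq> set \<beta>" for \<beta>
  proof (induction \<beta>)
    case (Cons j \<beta>)
    then show ?case
      using keys_add[of "Poly_Mapping.single j 1" "index_monomial \<beta>"] by (auto simp: index_monomial_def)
  qed (simp add: index_monomial_def)
  with i \<alpha> have "i \<in> set \<alpha>"
    by blast
  with \<alpha>(1) show "i \<in> {1..k}"
    using member_le_sum_list[of i \<alpha>] by (auto simp: compositions_def Suc_le_eq intro!: gr0I)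
qed

text \<open>Uniqueness needs only the case of \<open>k\<close> variables, in which the elementary symmetric polynomials
\<open>e\<^sub>1, \<dots>, e\<^sub>k\<close> are algebraically independent.\<close>
lemma hirzebruch_L_eq: "hirzebruch_L k = explicit_L k"
  unfolding hirzebruch_L_def
proof (rule the_equality)
  show L: "is_hirzebruch_L k (explicit_L k)"
    using mp_vars_explicit_L mp_subst_explicit_L by (auto simp: is_hirzebruch_L_def)
  fix P assume P: "is_hirzebruch_L k P"
  let ?D = "P - explicit_L k"
  have "mp_subst (elem_sym k) P = mp_subst (elem_sym k) ?D + mp_subst (elem_sym k) (explicit_L k)"
    by (simp flip: mp_subst_add)
  with P L have "mp_subst (elem_sym k) ?D = 0"
    by (simp add: is_hirzebruch_L_def)
  moreover have "mp_vars ?D \<subseteq> mp_vars P \<union> mp_vars (explicit_L k)"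
    using keys_diff[of P "explicit_L k"] by (auto simp: mp_vars_def)
  then have "mp_vars ?D \<subseteq> {1..k}"
    using P L by (auto simp: is_hirzebruch_L_def)
  ultimately show "P = explicit_L k"
    using elem_sym_independent[of ?D k] by simp
qed

section \<open>The zeros and poles of Q\<close>
abbreviation real_hirzebruch_Q :: "real fps" where
  "real_hirzebruch_Q \<equiv> Abs_fps (\<lambda>n. of_rat (fps_nth hirzebruch_Q n))"

lemma log_deriv_coeff_unique:
  fixes f :: "'a::field fps"
  assumes "fps_X * fps_deriv f = alternating q * f" "fps_nth f 0 \<noteq> 0" "n > 0"
  shows "log_deriv_coeff f n = q n"
proof -
  have "f \<noteq> 0"
    using assms(2) by auto
  moreover have "alternating (log_deriv_coeff f) * f = alternating q * f"
    using assms(1,2) by (simp add: log_deriv_coeff_eq)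
  ultimately have "fps_nth (alternating (log_deriv_coeff f)) n = fps_nth (alternating q) n"
    by simp
  with assms(3) show ?thesis
    by simp
qed

lemma log_deriv_coeff_mult:
  fixes f g :: "'a::field fps"
  assumes "fps_nth f 0 \<noteq> 0" "fps_nth g 0 \<noteq> 0" "n > 0"
  shows "log_deriv_coeff (f * g) n = log_deriv_coeff f n + log_deriv_coeff g n"
proof (rule log_deriv_coeff_unique)
  have "fps_X * fps_deriv (f * g) = (fps_X * fps_deriv f) * g + f * (fps_X * fps_deriv g)"
    by (simp add: algebra_simps)
  also have "\<dots> = (alternating (log_deriv_coeff f) + alternating (log_deriv_coeff g)) * (f * g)"
    by (simp only: log_deriv_coeff_eq[OF assms(1)] log_deriv_coeff_eq[OF assms(2)]) (simp only: algebra_simps)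
  also have "alternating (log_deriv_coeff f) + alternating (log_deriv_coeff g)
    = alternating (\<lambda>n. log_deriv_coeff f n + log_deriv_coeff g n)"
    by (rule fps_ext) (simp add: algebra_simps)
  finally show "fps_X * fps_deriv (f * g)
    = alternating (\<lambda>n. log_deriv_coeff f n + log_deriv_coeff g n) * (f * g)" .
qed (use assms in auto)

lemma log_deriv_coeff_of_rat:
  assumes "fps_nth f 0 \<noteq> 0" "n > 0"
  shows "log_deriv_coeff (Abs_fps (\<lambda>n. of_rat (fps_nth f n) :: 'a::field_char_0)) n = of_rat (log_deriv_coeff f n)"
proof (rule log_deriv_coeff_unique)
  let ?g = "Abs_fps (\<lambda>n. of_rat (fps_nth f n) :: 'a)"
  show "fps_X * fps_deriv ?g = alternating (\<lambda>n. of_rat (log_deriv_coeff f n)) * ?g"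
  proof (rule fps_ext)
    fix n
    have "fps_nth (fps_X * fps_deriv ?g) n = of_rat (fps_nth (fps_X * fps_deriv f) n)"
      by (cases n) (simp_all add: of_rat_mult of_rat_add)
    also have "\<dots> = of_rat (fps_nth (alternating (log_deriv_coeff f) * f) n)"
      by (simp only: log_deriv_coeff_eq[OF assms(1)])
    also have "\<dots> = fps_nth (alternating (\<lambda>n. of_rat (log_deriv_coeff f n)) * ?g) n"
      by (auto simp: fps_mult_nth of_rat_sum of_rat_mult of_rat_power of_rat_minus intro!: sum.cong)
    finally show "fps_nth (fps_X * fps_deriv ?g) n
      = fps_nth (alternating (\<lambda>n. of_rat (log_deriv_coeff f n)) * ?g) n" .
  qed
qed (use assms in auto)

lemma real_hirzebruch_Q_mult_sinhc: "real_hirzebruch_Q * fps_sinhc = fps_cosh_sqrt"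
proof (rule fps_ext)
  fix n
  have of_rat_fact: "real_of_rat (fact m) = fact m" for m
    by (metis of_nat_fact of_rat_of_nat_eq)
  have "fps_nth (real_hirzebruch_Q * fps_sinhc) n = of_rat (fps_nth (hirzebruch_Q * fps_sinhc) n)"
    by (simp add: fps_mult_nth fps_sinhc_def of_rat_sum of_rat_mult of_rat_divide of_rat_fact del: fact_Suc)
  then show "fps_nth (real_hirzebruch_Q * fps_sinhc) n = fps_nth fps_cosh_sqrt n"
    by (simp add: hirzebruch_Q_mult_sinhc fps_cosh_sqrt_def of_rat_divide of_rat_fact)
qed

lemma log_deriv_coeff_hirzebruch_Q:
  assumes "n > 0"
  shows "real_of_rat (log_deriv_coeff hirzebruch_Q n) = log_deriv_coeff fps_cosh_sqrt n - log_deriv_coeff fps_sinhc n"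
proof -
  have "log_deriv_coeff real_hirzebruch_Q n + log_deriv_coeff fps_sinhc n = log_deriv_coeff fps_cosh_sqrt n"
    using assms unfolding real_hirzebruch_Q_mult_sinhc[symmetric]
    by (intro log_deriv_coeff_mult[symmetric]) (auto simp: hirzebruch_Q_nth_0 fps_sinhc_def)
  then show ?thesis
    using assms by (simp add: log_deriv_coeff_of_rat hirzebruch_Q_nth_0)
qed

text \<open>Newton's recursion expresses the \<open>n\<close>-th power sum as a polynomial in the first \<open>n\<close> coefficients
of the series.\<close>
lemma tendsto_log_deriv_coeff:
  fixes F :: "nat \<Rightarrow> real fps" and f :: "real fps"
  assumes lim: "\<And>n. (\<lambda>N. fps_nth (F N) n) \<longlonglongrightarrow> fps_nth f n"
    and F: "\<And>N. fps_nth (F N) 0 = 1" and f: "fps_nth f 0 = 1"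
  shows "n > 0 \<Longrightarrow> (\<lambda>N. log_deriv_coeff (F N) n) \<longlonglongrightarrow> log_deriv_coeff f n"
proof (induction n rule: less_induct)
  case (less n)
  have rec: "log_deriv_coeff g n = (- 1) ^ (n - 1) * (of_nat n * fps_nth g n
      - (\<Sum>l\<in>{1..<n}. (- 1) ^ (l - 1) * log_deriv_coeff g l * fps_nth g (n - l)))"
    if g: "fps_nth g 0 = 1" for g :: "real fps"
  proof -
    have "of_nat n * fps_nth g n = fps_nth (fps_X * fps_deriv g) n"
      using less.prems by simp
    also have "\<dots> = (\<Sum>l=0..n. fps_nth (alternating (log_deriv_coeff g)) l * fps_nth g (n - l))"
      by (subst log_deriv_coeff_eq) (simp_all only: g fps_mult_nth one_neq_zero not_False_eq_True)
    also have "{0..n} = insert n (insert 0 {1..<n})"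
      using less.prems by auto
    also have "(\<Sum>l\<in>insert n (insert 0 {1..<n}). fps_nth (alternating (log_deriv_coeff g)) l * fps_nth g (n - l))
      = (- 1) ^ (n - 1) * log_deriv_coeff g n
        + (\<Sum>l\<in>{1..<n}. (- 1) ^ (l - 1) * log_deriv_coeff g l * fps_nth g (n - l))"
      using less.prems g by simp
    finally have "(- 1) ^ (n - 1) * (of_nat n * fps_nth g n
      - (\<Sum>l\<in>{1..<n}. (- 1) ^ (l - 1) * log_deriv_coeff g l * fps_nth g (n - l)))
      = ((- 1) ^ (n - 1) * (- 1) ^ (n - 1)) * log_deriv_coeff g n"
      by simp
    then show ?thesis
      by (simp flip: power_mult_distrib)
  qed
  show ?case
    unfolding rec[OF F] rec[OF f] by (intro tendsto_intros lim less.IH) auto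
qed

text \<open>A power series that is not zero has isolated zeros; it suffices to know that it vanishes to the right
of \<open>0\<close>.\<close>
lemma powser_eq_0:
  fixes d :: "nat \<Rightarrow> real"
  assumes "\<And>t. t \<ge> 0 \<Longrightarrow> (\<lambda>n. d n * t ^ n) sums 0"
  shows "d n = 0"
proof (rule ccontr)
  assume n: "d n \<noteq> 0"
  have "d 0 = 0"
    using assms[of 0] powser_sums_zero[of d] sums_unique2 by fastforce
  with n have "n > 0"
    by (cases n) auto
  let ?f = "\<lambda>t. suminf (\<lambda>n. d n * t ^ n)"
  have "(\<lambda>n. d n * (t - 0) ^ n) sums ?f t" if "norm (t - 0) < 1" for t
    using powser_inside[of d 1 t] sums_summable[OF assms[of 1]] that by (simp add: summable_sums)
  moreover have "?f 0 = 0"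
    using sums_unique[OF assms[of 0]] by simp
  ultimately obtain s where s: "0 < s" "\<And>z. z \<in> cball 0 s - {0} \<Longrightarrow> ?f z \<noteq> 0"
    using powser_0_nonzero[of 1 0 d ?f n] n \<open>n > 0\<close> by (metis zero_less_one)
  then have "?f s \<noteq> 0"
    by simp
  moreover have "?f s = 0"
    using sums_unique[OF assms[of s]] s(1) by simp
  ultimately show False
    by contradiction
qed

text \<open>Pointwise convergence of an infinite product with nonnegative letters on \<open>t \<ge> 0\<close> implies
convergence of its coefficients. The coefficients of the finite products increase and are
bounded by the value of the limit function at \<open>1\<close>, hence converge. By monotone convergence their limits are the
coefficients of the limit function.\<close>
context
  fixes a :: "nat \<Rightarrow> real" and f :: "real \<Rightarrow> real" and c :: "nat \<Rightarrow> real"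
  assumes a: "\<And>i. a i \<ge> 0"
    and lim: "\<And>t. t \<ge> 0 \<Longrightarrow> (\<lambda>N. \<Prod>i<N. 1 + a i * t) \<longlonglongrightarrow> f t"
    and c: "\<And>t. t \<ge> 0 \<Longrightarrow> (\<lambda>n. c n * t ^ n) sums f t"
begin

abbreviation "elem_coeff N n \<equiv> fps_nth (\<Prod>i<N. 1 + fps_const (a i) * fps_X) n"

lemma elem_coeff_Suc: "elem_coeff (Suc N) n = elem_coeff N n + (if n = 0 then 0 else a N * elem_coeff N (n - 1))"
proof -
  have "(\<Prod>i<Suc N. 1 + fps_const (a i) * fps_X)
    = (\<Prod>i<N. 1 + fps_const (a i) * fps_X) + fps_X * (fps_const (a N) * (\<Prod>i<N. 1 + fps_const (a i) * fps_X))"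
    by (simp add: algebra_simps)
  then show ?thesis
    by (cases n) simp_all
qed

lemma elem_coeff_nonneg: "elem_coeff N n \<ge> 0"
  using a by (induction N arbitrary: n) (auto simp: elem_coeff_Suc simp del: prod.lessThan_Suc)

lemma elem_coeff_incseq: "incseq (\<lambda>N. elem_coeff N n)"
  using a elem_coeff_nonneg by (intro incseq_SucI) (auto simp: elem_coeff_Suc simp del: prod.lessThan_Suc)

lemma elem_coeff_sums: "(\<lambda>n. elem_coeff N n * t ^ n) sums (\<Prod>i<N. 1 + a i * t)"
proof (induction N)
  case 0
  have "(\<lambda>n. fps_nth 1 n * t ^ n) = (\<lambda>n. if n = 0 then t ^ n else 0)"
    by auto
  then show ?case
    using sums_single[of 0 "\<lambda>n. t ^ n"] by simp
next
  case (Suc N)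
  have "(\<lambda>n. elem_coeff N n * t ^ n * (a N * t)) sums ((\<Prod>i<N. 1 + a i * t) * (a N * t))"
    using Suc by (rule sums_mult2)
  then have "(\<lambda>n. if n = 0 then 0 else a N * elem_coeff N (n - 1) * t ^ n) sums ((\<Prod>i<N. 1 + a i * t) * (a N * t))"
    using sums_Suc[of "\<lambda>n. if n = 0 then 0 else a N * elem_coeff N (n - 1) * t ^ n"] by (simp add: mult_ac)
  from sums_add[OF Suc this]
  have "(\<lambda>n. elem_coeff N n * t ^ n + (if n = 0 then 0 else a N * elem_coeff N (n - 1) * t ^ n))
    sums (\<Prod>i<Suc N. 1 + a i * t)"
    by (simp add: algebra_simps)
  moreover have "elem_coeff (Suc N) n * t ^ n
    = elem_coeff N n * t ^ n + (if n = 0 then 0 else a N * elem_coeff N (n - 1) * t ^ n)" for n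
    by (simp only: elem_coeff_Suc) (simp add: algebra_simps)
  ultimately show ?case
    by (simp only:)
qed

lemma linear_prod_le_limit: "t \<ge> 0 \<Longrightarrow> (\<Prod>i<N. 1 + a i * t) \<le> f t"
  using a by (intro incseq_le[OF _ lim] incseq_SucI)
    (auto simp: algebra_simps intro!: mult_nonneg_nonneg prod_nonneg add_nonneg_nonneg)

lemma elem_coeff_tendsto: "(\<lambda>N. elem_coeff N n) \<longlonglongrightarrow> c n"
proof -
  have "\<exists>e. (\<lambda>N. elem_coeff N n) \<longlonglongrightarrow> e \<and> (\<forall>N. elem_coeff N n \<le> e)" for n
  proof -
    have "elem_coeff N n \<le> f 1" for N
    proof -
      have "elem_coeff N n * 1 ^ n \<le> (\<Prod>i<N. 1 + a i * 1)"
        using sum_le_suminf[OF sums_summable[OF elem_coeff_sums[of N 1]], of "{n}"] elem_coeff_nonneg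
          sums_unique[OF elem_coeff_sums[of N 1]] by simp
      with linear_prod_le_limit[of 1 N] show ?thesis by simp
    qed
    then show ?thesis
      using incseq_convergent[OF elem_coeff_incseq] by (metis (no_types, lifting))
  qed
  then obtain e where e: "\<And>n. (\<lambda>N. elem_coeff N n) \<longlonglongrightarrow> e n" and le: "\<And>N n. elem_coeff N n \<le> e n"
    by metis
  have e_nonneg: "e n \<ge> 0" for n
    using le[of 0 n] elem_coeff_nonneg[of 0 n] by linarith
  have e_sums: "(\<lambda>n. e n * t ^ n) sums f t" if t: "t \<ge> 0" for t
  proof -
    have partial: "(\<Sum>n<M. e n * t ^ n) \<le> f t" for M
    proof (rule LIMSEQ_le_const2)
      show "(\<lambda>N. \<Sum>n<M. elem_coeff N n * t ^ n) \<longlonglongrightarrow> (\<Sum>n<M. e n * t ^ n)"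
        by (intro tendsto_intros e)
      have "(\<Sum>n<M. elem_coeff N n * t ^ n) \<le> f t" for N
      proof -
        have "(\<Sum>n<M. elem_coeff N n * t ^ n) \<le> (\<Prod>i<N. 1 + a i * t)"
          using sum_le_suminf[OF sums_summable[OF elem_coeff_sums[of N t]], of "{..<M}"] elem_coeff_nonneg t
            sums_unique[OF elem_coeff_sums[of N t]] by simp
        with linear_prod_le_limit[OF t, of N] show ?thesis by simp
      qed
      then show "\<exists>N. \<forall>n\<ge>N. (\<Sum>k<M. elem_coeff n k * t ^ k) \<le> f t"
        by blast
    qed
    then have summable: "summable (\<lambda>n. e n * t ^ n)"
      using e_nonneg t by (intro summableI_nonneg_bounded) auto
    have "f t \<le> suminf (\<lambda>n. e n * t ^ n)"
    proof (rule LIMSEQ_le_const2[OF lim[OF t]])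
      have "(\<Prod>i<N. 1 + a i * t) \<le> suminf (\<lambda>n. e n * t ^ n)" for N
        using le t by (intro sums_le[OF _ elem_coeff_sums summable_sums[OF summable]] mult_right_mono) auto
      then show "\<exists>N. \<forall>n\<ge>N. (\<Prod>i<n. 1 + a i * t) \<le> suminf (\<lambda>n. e n * t ^ n)"
        by blast
    qed
    moreover have "suminf (\<lambda>n. e n * t ^ n) \<le> f t"
      using summable partial by (rule suminf_le_const)
    ultimately show ?thesis
      using summable_sums[OF summable] by simp
  qed
  have "(\<lambda>n. (e n - c n) * t ^ n) sums 0" if "t \<ge> 0" for t
    using sums_diff[OF e_sums[OF that] c[OF that]] by (simp add: left_diff_distrib)
  then have "e n - c n = 0"
    by (rule powser_eq_0)
  with e[of n] show ?thesis
    by simp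
qed

lemma power_sum_tendsto:
  assumes "n > 0" "c 0 = 1"
  shows "(\<lambda>N. \<Sum>i<N. a i ^ n) \<longlonglongrightarrow> log_deriv_coeff (Abs_fps c) n"
proof -
  let ?F = "\<lambda>N. \<Prod>i<N. 1 + fps_const (a i) * fps_X"
  have F: "fps_nth (?F N) 0 = 1" for N
    by (induction N) (auto simp: elem_coeff_Suc simp del: prod.lessThan_Suc)
  have "log_deriv_coeff (?F N) n = (\<Sum>i<N. a i ^ n)" for N
    using F assms(1) by (intro log_deriv_coeff_unique log_deriv_prod_linear) auto
  moreover have "(\<lambda>N. log_deriv_coeff (?F N) n) \<longlonglongrightarrow> log_deriv_coeff (Abs_fps c) n"
    using elem_coeff_tendsto F assms by (intro tendsto_log_deriv_coeff) auto
  ultimately show ?thesis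
    by simp
qed

end

text \<open>The negative inverse zeros of \<open>sinh \<surd>z / \<surd>z\<close> and of \<open>cosh \<surd>z\<close>, which are the poles and the zeros of
\<open>\<surd>z / tanh \<surd>z\<close>.\<close>
definition sinhc_letter :: "nat \<Rightarrow> real" where
  "sinhc_letter i = 1 / (pi * real (i + 1)) ^ 2"

definition cosh_letter :: "nat \<Rightarrow> real" where
  "cosh_letter i = 4 / (pi * real (2 * i + 1)) ^ 2"

definition sinhc_sqrt :: "real \<Rightarrow> real" where
  "sinhc_sqrt t = (if t = 0 then 1 else sinh (sqrt t) / sqrt t)"

lemma sinhc_sqrt_sums:
  assumes "t \<ge> 0"
  shows "(\<lambda>n. 1 / fact (2 * n + 1) * t ^ n) sums sinhc_sqrt t"
proof (cases "t = 0")
  case True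
  then show ?thesis
    using powser_sums_zero[of "\<lambda>n. 1 / fact (2 * n + 1) :: real"] by (simp add: sinhc_sqrt_def)
next
  case False
  let ?g = "\<lambda>n. if even n then 0 else sqrt t ^ n /\<^sub>R fact n"
  have "(\<lambda>n. ?g (2 * n + 1)) sums sinh (sqrt t) \<longleftrightarrow> ?g sums sinh (sqrt t)"
    by (rule sums_mono_reindex) (auto simp: strict_mono_def elim!: oddE)
  then have "(\<lambda>n. ?g (2 * n + 1) / sqrt t) sums (sinh (sqrt t) / sqrt t)"
    using sinh_converges[of "sqrt t"] by (intro sums_divide) simp
  moreover have "?g (2 * n + 1) / sqrt t = 1 / fact (2 * n + 1) * t ^ n" for n
  proof -
    have "sqrt t ^ (2 * n) = t ^ n"
      using assms by (metis power_mult real_sqrt_pow2)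
    then have "sqrt t ^ (2 * n + 1) = sqrt t * t ^ n"
      by simp
    with False show ?thesis
      by (simp add: divide_inverse del: fact_Suc power_Suc)
  qed
  ultimately show ?thesis
    using False by (simp add: sinhc_sqrt_def)
qed

lemma cosh_sqrt_sums:
  assumes "t \<ge> 0"
  shows "(\<lambda>n. 1 / fact (2 * n) * t ^ n) sums cosh (sqrt t)"
proof -
  let ?g = "\<lambda>n. if even n then sqrt t ^ n /\<^sub>R fact n else 0"
  have "(\<lambda>n. ?g (2 * n)) sums cosh (sqrt t) \<longleftrightarrow> ?g sums cosh (sqrt t)"
    by (rule sums_mono_reindex) (auto simp: strict_mono_def elim!: evenE)
  then have "(\<lambda>n. ?g (2 * n)) sums cosh (sqrt t)"
    using cosh_converges[of "sqrt t"] by simp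
  moreover have "sqrt t ^ (2 * n) = t ^ n" for n
    using assms by (metis power_mult real_sqrt_pow2)
  then have "?g (2 * n) = 1 / fact (2 * n) * t ^ n" for n
    by (simp add: divide_inverse)
  ultimately show ?thesis
    by simp
qed

text \<open>The product formula for the sine, evaluated on the imaginary axis.\<close>
lemma sinhc_product:
  assumes "t \<ge> 0"
  shows "(\<lambda>N. \<Prod>i<N. 1 + sinhc_letter i * t) \<longlonglongrightarrow> sinhc_sqrt t"
proof (cases "t = 0")
  case False
  \<comment> \<open>The sine is evaluated at \<open>w\<close>, where \<open>w\<^sup>2 = - t\<close>.\<close>
  define w where "w = \<i> * of_real (sqrt t)"
  have w: "w \<noteq> 0"
    using False by (simp add: w_def)
  have w2: "w\<^sup>2 = - of_real t"
    using assms by (simp add: w_def power_mult_distrib flip: of_real_power)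
  have sinh: "complex_of_real (sinh (sqrt t)) = sinh (complex_of_real (sqrt t))"
    by (simp add: sinh_field_def exp_of_real flip: of_real_minus)
  have "(\<lambda>n. of_real pi * (w / of_real pi) * (\<Prod>k=1..n. 1 - (w / of_real pi)^2 / of_nat k^2) / w)
    \<longlonglongrightarrow> sin (of_real pi * (w / of_real pi)) / w"
    by (intro tendsto_divide sin_product_formula_complex tendsto_const w)
  also have "sin (of_real pi * (w / of_real pi)) / w = of_real (sinhc_sqrt t)"
    using False assms sinh_conv_sin[of "of_real (sqrt t)"]
    by (simp add: w_def sinhc_sqrt_def sinh field_simps)
  also have "(\<lambda>n. of_real pi * (w / of_real pi) * (\<Prod>k=1..n. 1 - (w / of_real pi)^2 / of_nat k^2) / w)
    = (\<lambda>N. of_real (\<Prod>i<N. 1 + sinhc_letter i * t))"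
  proof
    fix N
    have "(\<Prod>k=1..N. 1 - (w / of_real pi)^2 / of_nat k^2) = (\<Prod>i<N. 1 - (w / of_real pi)^2 / of_nat (Suc i)^2)"
      by (rule prod.reindex_bij_witness[of _ Suc "\<lambda>i. i - 1"]) auto
    also have "\<dots> = of_real (\<Prod>i<N. 1 + sinhc_letter i * t)"
      unfolding of_real_prod
      by (intro prod.cong) (simp_all add: power_divide w2 sinhc_letter_def power_mult_distrib add.commute)
    finally show "of_real pi * (w / of_real pi) * (\<Prod>k=1..N. 1 - (w / of_real pi)^2 / of_nat k^2) / w
      = of_real (\<Prod>i<N. 1 + sinhc_letter i * t)"
      using w by simp
  qed
  finally show ?thesis
    by (simp only: tendsto_of_real_iff)
qed (simp add: sinhc_sqrt_def)

text \<open>By \<open>sinh (2 w) = 2 sinh w cosh w\<close>, the product for the hyperbolic cosine is the quotient of the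
products for \<open>sinh (2 w)\<close> and \<open>sinh w\<close>: the
factors \<open>1 + 4 t / (\<pi> k)\<^sup>2\<close> with even \<open>k\<close> cancel, and those with odd \<open>k\<close> remain.\<close>
lemma cosh_product:
  assumes "t \<ge> 0"
  shows "(\<lambda>N. \<Prod>i<N. 1 + cosh_letter i * t) \<longlonglongrightarrow> cosh (sqrt t)"
proof -
  have pos: "1 + sinhc_letter i * s > 0" if "s \<ge> 0" for i s
    using that by (intro add_pos_nonneg) (auto simp: sinhc_letter_def)
  have split: "(\<Prod>i<2 * N. 1 + sinhc_letter i * (4 * t))
    = (\<Prod>i<N. 1 + cosh_letter i * t) * (\<Prod>i<N. 1 + sinhc_letter i * t)" for N
  proof (induction N)
    case (Suc N)
    have "sinhc_letter (2 * N) * (4 * t) = cosh_letter N * t"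
      by (simp add: sinhc_letter_def cosh_letter_def)
    moreover have "sinhc_letter (Suc (2 * N)) * (4 * t) = sinhc_letter N * t"
    proof -
      have "pi * real (Suc (2 * N) + 1) = 2 * (pi * real (N + 1))"
        by (simp add: algebra_simps)
      then show ?thesis
        unfolding sinhc_letter_def by (simp only: power_mult_distrib) simp
    qed
    moreover have "(\<Prod>i<2 * Suc N. 1 + sinhc_letter i * (4 * t))
      = (\<Prod>i<2 * N. 1 + sinhc_letter i * (4 * t))
        * ((1 + sinhc_letter (2 * N) * (4 * t)) * (1 + sinhc_letter (Suc (2 * N)) * (4 * t)))"
      by simp
    ultimately show ?case
      using Suc by (simp only: prod.lessThan_Suc) (simp only: mult_ac)
  qed simp
  have ne: "(\<Prod>i<N. 1 + sinhc_letter i * t) \<noteq> 0" for N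
    using pos[OF assms] by (simp add: less_imp_neq[THEN not_sym])
  have g: "sinhc_sqrt t \<noteq> 0"
    using assms by (auto simp: sinhc_sqrt_def)
  have "filterlim (\<lambda>N::nat. 2 * N) sequentially sequentially"
    by (intro filterlim_subseq) (simp add: strict_mono_def)
  then have "(\<lambda>N. (\<Prod>i<2 * N. 1 + sinhc_letter i * (4 * t)) / (\<Prod>i<N. 1 + sinhc_letter i * t))
    \<longlonglongrightarrow> sinhc_sqrt (4 * t) / sinhc_sqrt t"
    using assms g by (intro tendsto_divide sinhc_product filterlim_compose[OF sinhc_product]) auto
  also have "sinhc_sqrt (4 * t) / sinhc_sqrt t = cosh (sqrt t)"
    using sinh_double[of "sqrt t"] assms by (auto simp: sinhc_sqrt_def real_sqrt_mult field_simps)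
  finally show ?thesis
    using ne by (simp add: split)
qed

lemma power_sums_tendsto_log_deriv_Q:
  assumes "n > 0"
  shows "(\<lambda>N. (\<Sum>i\<le>N. cosh_letter i ^ n) - (\<Sum>i<N. sinhc_letter i ^ n))
    \<longlonglongrightarrow> of_rat (log_deriv_coeff hirzebruch_Q n)"
proof -
  have "(\<lambda>N. \<Sum>i<N. cosh_letter i ^ n) \<longlonglongrightarrow> log_deriv_coeff fps_cosh_sqrt n"
    unfolding fps_cosh_sqrt_def using assms
    by (intro power_sum_tendsto[where f = "\<lambda>t. cosh (sqrt t)"] cosh_product cosh_sqrt_sums)
      (auto simp: cosh_letter_def)
  then have "(\<lambda>N. \<Sum>i\<le>N. cosh_letter i ^ n) \<longlonglongrightarrow> log_deriv_coeff fps_cosh_sqrt n"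
    unfolding lessThan_Suc_atMost[symmetric] by (rule LIMSEQ_Suc)
  moreover have "(\<lambda>N. \<Sum>i<N. sinhc_letter i ^ n) \<longlonglongrightarrow> log_deriv_coeff fps_sinhc n"
    unfolding fps_sinhc_def using assms
    by (intro power_sum_tendsto[where f = sinhc_sqrt] sinhc_product sinhc_sqrt_sums)
      (auto simp: sinhc_letter_def)
  ultimately show ?thesis
    unfolding log_deriv_coeff_hirzebruch_Q[OF assms] by (rule tendsto_diff)
qed

section \<open>The sign of the coefficients\<close>
lemma lookup_index_monomial: "Poly_Mapping.lookup (index_monomial \<alpha>) j = count (mset \<alpha>) j"
  by (induction \<alpha>) (auto simp: index_monomial_def lookup_add lookup_single when_def)

lemma length_eq_of_index_monomial_eq:
  "index_monomial \<alpha> = index_monomial \<beta> \<Longrightarrow> length \<alpha> = length \<beta>"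
  by (metis lookup_index_monomial multiset_eqI size_mset)

lemma letters_interlace:
  "0 < sinhc_letter i" "sinhc_letter i < cosh_letter i" "cosh_letter (Suc i) < sinhc_letter i"
proof -
  have pi2: "0 < pi\<^sup>2" by simp
  have "(2 * real i + 1)\<^sup>2 < 4 * (real i + 1)\<^sup>2" "4 * (real i + 1)\<^sup>2 < (2 * real i + 3)\<^sup>2"
    by (auto simp: power2_eq_square algebra_simps)
  then show "0 < sinhc_letter i" "sinhc_letter i < cosh_letter i" "cosh_letter (Suc i) < sinhc_letter i"
    using pi2
    by (auto simp: sinhc_letter_def cosh_letter_def power_mult_distrib divide_simps add.commute mult_ac)
qed

theorem corollary3:
  fixes k :: nat and js :: "nat list"
  assumes "k \<ge> 1"
    and "is_partition js k"
  shows "L_coeff js k \<noteq> 0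
    \<and> (even (length js) \<longrightarrow> L_coeff js k < 0)
    \<and> (odd (length js) \<longrightarrow> L_coeff js k > 0)"
proof -
  \<comment> \<open>The words that become the monomial of \<open>js\<close> when the indeterminates commute. They are the
    rearrangements of \<open>js\<close>, so they all have the same length and hence the same sign.\<close>
  define R where "R = {\<alpha>. \<alpha> \<in> compositions k \<and> index_monomial \<alpha> = index_monomial js}"
  let ?q = "log_deriv_coeff hirzebruch_Q"
  let ?q' = "\<lambda>N m. (\<Sum>l\<le>N. cosh_letter l ^ m) - (\<Sum>l<N. sinhc_letter l ^ m)"
  let ?M = "alphabet_qsym cosh_letter sinhc_letter"
  let ?gap = "sign_gap cosh_letter sinhc_letter"
  have js: "js \<in> R"
    using assms(2) by (auto simp: R_def is_partition_def compositions_def)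
  have fin: "finite R"
    unfolding R_def by simp
  have R: "0 \<notin> set \<alpha>" "\<alpha> \<noteq> []" "length \<alpha> = length js" if "\<alpha> \<in> R" for \<alpha>
    using that assms(1) length_eq_of_index_monomial_eq[of \<alpha> js]
    by (auto simp: R_def compositions_def)
  have L: "L_coeff js k = (\<Sum>\<alpha>\<in>R. log_deriv_solution ?q \<alpha>)"
    unfolding L_coeff_def mp_coeff_def hirzebruch_L_eq explicit_L_def lookup_comp_series_variable R_def ..
  \<comment> \<open>\<open>?q' N\<close> are the power sums of a finite alphabet, so the limit is taken of
    sums of quasisymmetric functions with known sign.\<close>
  have "(\<lambda>N. \<Sum>\<alpha>\<in>R. log_deriv_solution (?q' N) \<alpha>)
    \<longlonglongrightarrow> (\<Sum>\<alpha>\<in>R. log_deriv_solution (\<lambda>n. of_rat (?q n)) \<alpha>)"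
    by (intro tendsto_sum tendsto_log_deriv_solution power_sums_tendsto_log_deriv_Q R)
  then have "(\<lambda>N. \<Sum>\<alpha>\<in>R. ?M N \<alpha>) \<longlonglongrightarrow> of_rat (L_coeff js k)"
    unfolding L of_rat_sum log_deriv_solution_of_rat
    unfolding R_def symmetrized_coeffs_eq .
  then have lim: "(\<lambda>N. - ((- 1) ^ length js) * (\<Sum>\<alpha>\<in>R. ?M N \<alpha>))
    \<longlonglongrightarrow> - ((- 1) ^ length js) * of_rat (L_coeff js k)"
    by (intro tendsto_mult tendsto_const)
  have "(\<Sum>\<alpha>\<in>R. ?gap \<alpha>) \<le> - ((- 1) ^ length js) * (\<Sum>\<alpha>\<in>R. ?M N \<alpha>)" if "N > 0" for N
    unfolding sum_distrib_left
  proof (rule sum_mono)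
    fix \<alpha> assume "\<alpha> \<in> R"
    then show "?gap \<alpha> \<le> - ((- 1) ^ length js) * ?M N \<alpha>"
      using alphabet_qsym_sign[of sinhc_letter cosh_letter \<alpha> N] letters_interlace R[of \<alpha>] that by simp
  qed
  then have "(\<Sum>\<alpha>\<in>R. ?gap \<alpha>) \<le> - ((- 1) ^ length js) * of_rat (L_coeff js k)"
    by (intro LIMSEQ_le_const[OF lim]) (auto intro!: exI[of _ 1])
  moreover have "0 < (\<Sum>\<alpha>\<in>R. ?gap \<alpha>)"
    using js fin by (intro sum_pos sign_gap_pos letters_interlace R) auto
  ultimately have "0 < - ((- 1) ^ length js) * real_of_rat (L_coeff js k)"
    by linarith
  then show ?thesis
    by (cases "even (length js)") auto
qed

end
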